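(* Let $x=x(q)$, $y=y(q)$, $z=z(q)$ be the septic theta quotients defined in the context and let $\mathcal{P}=\mathcal{P}(q)=E_2(q^7)$. Then \begin{align*} q\frac{d}{dq}x &= \frac{x}{12}\Bigl(5y^2+5z^2-7x^2-20yz-52xy+7\mathcal{P}\Bigr),\\ q\frac{d}{dq}y &= \frac{y}{12}\Bigl(5z^2+5x^2-7y^2+20xz-52yz+7\mathcal{P}\Bigr),\\ q\frac{d}{dq}z &= \frac{z}{12}\Bigl(5x^2+5y^2-7z^2-20xy+52xz+7\mathcal{P}\Bigr),\\ q\frac{d}{dq}\mathcal{P} &= \frac{7}{12}\Bigl(\mathcal{P}^2-x^4+4x^3y+12xy^3-y^4-12x^3z+4y^3z-4xz^3+12yz^3-z^4\Bigr). \end{align*}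
   Context: Let $0<|q|<1$, $q=e^{2\pi i\tau}$ with $\operatorname{Im}\tau>0$; fractional powers mean $q^r=e^{2\pi i r\tau}$. Write $(a;q)_\infty=\prod_{k=0}^{\infty}(1-aq^k)$. Define $$a(q)=-\sum_{n=-\infty}^{\infty}(-1)^nq^{(14n+5)^2/56},\quad b(q)=\sum_{n=-\infty}^{\infty}(-1)^nq^{(14n+3)^2/56},\quad c(q)=\sum_{n=-\infty}^{\infty}(-1)^nq^{(14n+1)^2/56},$$ $$x(q)=q^{7/8}(q^7;q^7)_\infty^3\frac{b(q)}{c^2(q)},\quad y(q)=-q^{7/8}(q^7;q^7)_\infty^3\frac{a(q)}{b^2(q)},\quad z(q)=q^{7/8}(q^7;q^7)_\infty^3\frac{c(q)}{a^2(q)}.$$ These quotients have expansions in integer powers of $q$ and so are functions of $q$. Also $E_2(q)=1-24\sum_{n=1}^{\infty}\bigl(\sum_{d\mid n}d\bigr)q^n$, so $\mathcal{P}(q)=E_2(q^7)=1-24\sum_{n=1}^\infty\bigl(\sum_{d\mid n}d\bigr)q^{7n}$. *)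

theory Defs
  imports "HOL-Analysis.Analysis"
begin

text \<open>
  The fractional power \<open>q\<^sup>r = exp (2 \<pi> i r \<tau>)\<close> depends on \<open>\<tau>\<close>, not only on \<open>q = exp (2 \<pi> i \<tau>)\<close>.
  Hence everything involving fractional powers is defined as a function of \<open>\<tau>\<close>.
\<close>

definition qpow :: "complex \<Rightarrow> real \<Rightarrow> complex" where
  "qpow \<tau> r = exp (2 * of_real pi * \<i> * of_real r * \<tau>)"

definition qpoch_inf :: "complex \<Rightarrow> complex \<Rightarrow> complex" where
  "qpoch_inf a q = (\<Prod>k. 1 - a * q ^ k)"

definition theta7 :: "nat \<Rightarrow> complex \<Rightarrow> complex" where
  "theta7 m \<tau> = (\<Sum>\<^sub>\<infinity>n::int. (-1) powi n * qpow \<tau> ((14 * of_int n + of_nat m)\<^sup>2 / 56))"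

definition a_tau :: "complex \<Rightarrow> complex" where "a_tau \<tau> = - theta7 5 \<tau>"
definition b_tau :: "complex \<Rightarrow> complex" where "b_tau \<tau> = theta7 3 \<tau>"
definition c_tau :: "complex \<Rightarrow> complex" where "c_tau \<tau> = theta7 1 \<tau>"

definition x_tau :: "complex \<Rightarrow> complex" where
  "x_tau \<tau> = qpow \<tau> (7/8) * qpoch_inf (qpow \<tau> 1 ^ 7) (qpow \<tau> 1 ^ 7) ^ 3 * (b_tau \<tau> / c_tau \<tau> ^ 2)"

definition y_tau :: "complex \<Rightarrow> complex" where
  "y_tau \<tau> = - qpow \<tau> (7/8) * qpoch_inf (qpow \<tau> 1 ^ 7) (qpow \<tau> 1 ^ 7) ^ 3 * (a_tau \<tau> / b_tau \<tau> ^ 2)"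

definition z_tau :: "complex \<Rightarrow> complex" where
  "z_tau \<tau> = qpow \<tau> (7/8) * qpoch_inf (qpow \<tau> 1 ^ 7) (qpow \<tau> 1 ^ 7) ^ 3 * (c_tau \<tau> / a_tau \<tau> ^ 2)"

text \<open>
  The quotients as functions of \<open>q\<close>, obtained by evaluating at one \<open>\<tau>\<close> with \<open>exp (2 \<pi> i \<tau>) = q\<close>.
  The choice of \<open>\<tau>\<close> is irrelevant by \<open>x_of_q_exp\<close>, \<open>y_of_q_exp\<close> and \<open>z_of_q_exp\<close> below, so the
  branch cut of \<^const>\<open>Ln\<close> plays no role.
\<close>

definition tau_of_q :: "complex \<Rightarrow> complex" where
  "tau_of_q q = Ln q / (2 * of_real pi * \<i>)"

definition x_of_q :: "complex \<Rightarrow> complex" where "x_of_q q = x_tau (tau_of_q q)"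
definition y_of_q :: "complex \<Rightarrow> complex" where "y_of_q q = y_tau (tau_of_q q)"
definition z_of_q :: "complex \<Rightarrow> complex" where "z_of_q q = z_tau (tau_of_q q)"

text \<open>The sum over \<open>n \<ge> 1\<close> is shifted to start at \<open>0\<close>.\<close>

definition E2 :: "complex \<Rightarrow> complex" where
  "E2 q = 1 - 24 * (\<Sum>n. of_nat (\<Sum>d | d dvd Suc n. d) * q ^ Suc n)"

definition P_of_q :: "complex \<Rightarrow> complex" where "P_of_q q = E2 (q ^ 7)"

lemma qpow_add_tau: "qpow (\<tau> + of_int k) r = qpow (of_int k) r * qpow \<tau> r"
  by (simp add: qpow_def exp_add ring_distribs mult_ac)

lemma qpow_add: "qpow \<tau> (r + s) = qpow \<tau> r * qpow \<tau> s"
  by (simp add: qpow_def exp_add ring_distribs)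

lemma qpow_power: "qpow \<tau> r ^ n = qpow \<tau> (of_nat n * r)"
  by (simp add: qpow_def exp_of_nat_mult [symmetric] mult_ac)

lemma qpow_of_int: "qpow (of_int k) (of_int m) = 1"
  using exp_integer_2pi [of "of_int (k * m)"] by (simp add: qpow_def mult_ac)

lemma qpow_neq_0: "qpow \<tau> r \<noteq> 0"
  by (simp add: qpow_def)

lemma theta7_add_int:
  assumes "odd m"
  shows "theta7 m (\<tau> + of_int k) = qpow (of_int k) ((of_nat m)\<^sup>2 / 56) * theta7 m \<tau>"
proof -
  have "qpow (of_int k) ((14 * of_int n + of_nat m)\<^sup>2 / 56) = qpow (of_int k) ((of_nat m)\<^sup>2 / 56)"
    for n :: int
  proof -
    have "even (7 * n\<^sup>2 + int m * n)"
      using assms by simp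
    then obtain j where j: "7 * n\<^sup>2 + int m * n = 2 * j" by (elim evenE)
    have "7 * (of_int n)\<^sup>2 + real m * of_int n = 2 * real_of_int j"
      using arg_cong [OF j, of real_of_int] by simp
    hence "(14 * of_int n + of_nat m)\<^sup>2 / 56 = real_of_int j + (of_nat m)\<^sup>2 / 56"
      by (simp add: power2_eq_square field_simps)
    thus ?thesis by (simp only: qpow_add qpow_of_int mult_1)
  qed
  hence "theta7 m (\<tau> + of_int k) = (\<Sum>\<^sub>\<infinity>n::int. qpow (of_int k) ((of_nat m)\<^sup>2 / 56) *
           ((-1) powi n * qpow \<tau> ((14 * of_int n + of_nat m)\<^sup>2 / 56)))"
    by (simp add: theta7_def qpow_add_tau mult_ac)
  thus ?thesis
    by (simp add: theta7_def infsum_cmult_right')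
qed

lemma qpow_quotient:
  assumes "r + s - 2 * t = of_int m"
  shows "qpow (of_int k) r * (qpow (of_int k) s / qpow (of_int k) t ^ 2) = 1"
proof -
  have "r + s = of_int m + 2 * t" using assms by simp
  hence "qpow (of_int k) r * qpow (of_int k) s = qpow (of_int k) t ^ 2"
    by (simp add: qpow_add [symmetric] qpow_power) (simp add: qpow_add qpow_of_int)
  thus ?thesis by (simp add: qpow_neq_0)
qed

lemma qpow_1_add_int: "qpow (\<tau> + of_int k) 1 = qpow \<tau> 1"
  using qpow_of_int [of k 1] by (simp add: qpow_add_tau)

lemma x_tau_add_int: "x_tau (\<tau> + of_int k) = x_tau \<tau>"
proof -
  let ?Q = "\<lambda>r. qpow (of_int k) r"
  have "x_tau (\<tau> + of_int k) = (?Q (7/8) * (?Q (9/56) / ?Q (1/56) ^ 2)) * x_tau \<tau>"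
    unfolding x_tau_def b_tau_def c_tau_def qpow_1_add_int
    by (simp add: theta7_add_int qpow_add_tau power_mult_distrib mult_ac)
  thus ?thesis using qpow_quotient [of "7/8" "9/56" "1/56" 1 k] by simp
qed

lemma y_tau_add_int: "y_tau (\<tau> + of_int k) = y_tau \<tau>"
proof -
  let ?Q = "\<lambda>r. qpow (of_int k) r"
  have "y_tau (\<tau> + of_int k) = (?Q (7/8) * (?Q (25/56) / ?Q (9/56) ^ 2)) * y_tau \<tau>"
    unfolding y_tau_def a_tau_def b_tau_def qpow_1_add_int
    by (simp add: theta7_add_int qpow_add_tau power_mult_distrib mult_ac)
  thus ?thesis using qpow_quotient [of "7/8" "25/56" "9/56" 1 k] by simp
qed

lemma z_tau_add_int: "z_tau (\<tau> + of_int k) = z_tau \<tau>"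
proof -
  let ?Q = "\<lambda>r. qpow (of_int k) r"
  have "z_tau (\<tau> + of_int k) = (?Q (7/8) * (?Q (1/56) / ?Q (25/56) ^ 2)) * z_tau \<tau>"
    unfolding z_tau_def a_tau_def c_tau_def qpow_1_add_int
    by (simp add: theta7_add_int qpow_add_tau power_mult_distrib mult_ac)
  thus ?thesis using qpow_quotient [of "7/8" "1/56" "25/56" 0 k] by simp
qed

lemma tau_of_q_exp: "\<exists>k::int. tau_of_q (exp (2 * of_real pi * \<i> * \<tau>)) = \<tau> + of_int k"
proof -
  have "exp (Ln (exp (2 * of_real pi * \<i> * \<tau>))) = exp (2 * of_real pi * \<i> * \<tau>)"
    by simp
  then obtain k :: int where
    "Ln (exp (2 * of_real pi * \<i> * \<tau>)) = 2 * of_real pi * \<i> * \<tau> + of_int (2 * k) * pi * \<i>"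
    unfolding exp_eq by blast
  hence "tau_of_q (exp (2 * of_real pi * \<i> * \<tau>)) = \<tau> + of_int k"
    by (simp add: tau_of_q_def field_simps)
  thus ?thesis ..
qed

lemma x_of_q_exp: "x_of_q (exp (2 * of_real pi * \<i> * \<tau>)) = x_tau \<tau>"
  using tau_of_q_exp [of \<tau>] by (auto simp: x_of_q_def x_tau_add_int)

lemma y_of_q_exp: "y_of_q (exp (2 * of_real pi * \<i> * \<tau>)) = y_tau \<tau>"
  using tau_of_q_exp [of \<tau>] by (auto simp: y_of_q_def y_tau_add_int)

lemma z_of_q_exp: "z_of_q (exp (2 * of_real pi * \<i> * \<tau>)) = z_tau \<tau>"
  using tau_of_q_exp [of \<tau>] by (auto simp: z_of_q_def z_tau_add_int)

end

theory Submission
  imports Defs "HOL-Complex_Analysis.Complex_Analysis"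
begin

text \<open>
  Put \<open>\<Theta>\<^sub>v(s) = \<Sum>n. (-1)\<^sup>n exp ((2 n + 1 + v)\<^sup>2 t + (2 n + 1 + v) s)\<close>. Rearranging the double series of
  \<open>\<Theta>\<^bsub>v+v'\<^esub>(s+s') \<Theta>\<^bsub>v-v'\<^esub>(s-s')\<close> writes this product as a \<open>2 \<times> 2\<close> determinant, so that the Pluecker relation
  gives Weierstrass's three-term identity. Its Taylor expansions at \<open>0\<close> express the second and third
  logarithmic derivatives of \<open>\<Theta>\<close> as theta quotients and give the addition formula for the first one.
  At the septic characteristics \<open>v = 2/7, 4/7, 6/7\<close> all these quotients are monomials in \<open>x, y, z\<close>:
  this yields \<open>x z = x y + y z\<close>, and the first logarithmic derivatives become linear forms in \<open>x, y, z\<close>.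

  The heat equation turns derivatives in \<open>t\<close> into derivatives in \<open>s\<close>, whence \<open>x'\<close>, \<open>y'\<close>, \<open>z'\<close> are polynomials in
  \<open>x\<close>, \<open>y\<close>, \<open>z\<close>, \<open>\<P>\<close> and one unknown second logarithmic derivative. The latter is determined by differentiating
  the linear forms in two ways, and differentiating the resulting formula for \<open>\<P>\<close> gives \<open>\<P>'\<close>.
  The triple product identity supplies the non-vanishing of the theta constants and the equality of
  \<open>\<Theta>\<^sub>0'(0)\<close> with the factor \<open>2 q\<^bsup>7/8\<^esup> (q\<^sup>7; q\<^sup>7)\<^sup>3\<close>, whose logarithmic derivative is \<open>7 \<P> / 8\<close>.
\<close>

section \<open>Infinite sums over the integers\<close>

text \<open>The M-test makes the finite partial sums converge uniformly on the disc, and by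
  Weierstrass's theorem uniform limits of holomorphic functions may be differentiated termwise.
  Hence a majorant of the terms suffices; convergence of the differentiated sums comes with the
  theorem.\<close>

lemma has_field_derivative_infsum_dominated:
  fixes f :: "'a \<Rightarrow> complex \<Rightarrow> complex"
  assumes r: "r > 0"
    and deriv: "\<And>n w. n \<in> A \<Longrightarrow> w \<in> cball z r \<Longrightarrow> (f n has_field_derivative f' n w) (at w)"
    and le: "\<And>n w. n \<in> A \<Longrightarrow> w \<in> cball z r \<Longrightarrow> norm (f n w) \<le> M n"
    and M: "M summable_on A"
  shows "((\<lambda>w. \<Sum>\<^sub>\<infinity>n\<in>A. f n w) has_field_derivative (\<Sum>\<^sub>\<infinity>n\<in>A. f' n z)) (at z)"
proof -
  let ?F = "finite_subsets_at_top A"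
  have ulim: "uniform_limit (cball z r) (\<lambda>X w. \<Sum>n\<in>X. f n w) (\<lambda>w. \<Sum>\<^sub>\<infinity>n\<in>A. f n w) ?F"
    by (rule Weierstrass_m_test_general [OF le M])
  have ev: "\<forall>\<^sub>F X in ?F. continuous_on (cball z r) (\<lambda>w. \<Sum>n\<in>X. f n w) \<and>
      (\<forall>w\<in>ball z r. ((\<lambda>w. \<Sum>n\<in>X. f n w) has_field_derivative (\<Sum>n\<in>X. f' n w)) (at w))"
  proof (rule eventually_finite_subsets_at_top_weakI, intro conjI ballI)
    fix X assume X: "finite X" "X \<subseteq> A"
    have "((\<lambda>w. \<Sum>n\<in>X. f n w) has_field_derivative (\<Sum>n\<in>X. f' n w)) (at w)"
      if "w \<in> cball z r" for w
      using X deriv that by (intro DERIV_sum) auto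
    thus "continuous_on (cball z r) (\<lambda>w. \<Sum>n\<in>X. f n w)"
      and "\<And>w. w \<in> ball z r \<Longrightarrow>
        ((\<lambda>w. \<Sum>n\<in>X. f n w) has_field_derivative (\<Sum>n\<in>X. f' n w)) (at w)"
      by (auto intro!: DERIV_atLeastAtMost_imp_continuous_on continuous_at_imp_continuous_on
          DERIV_isCont)
  qed
  obtain g' where g': "\<And>w. w \<in> ball z r \<Longrightarrow>
      ((\<lambda>w. \<Sum>\<^sub>\<infinity>n\<in>A. f n w) has_field_derivative g' w) (at w) \<and>
      ((\<lambda>X. \<Sum>n\<in>X. f' n w) \<longlongrightarrow> g' w) ?F"
    using has_complex_derivative_uniform_limit [OF ev ulim finite_subsets_at_top_neq_bot r] by metis
  have "((\<lambda>n. f' n z) has_sum g' z) A"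
    unfolding has_sum_def using g' [of z] r by simp
  hence "(\<Sum>\<^sub>\<infinity>n\<in>A. f' n z) = g' z" by (rule infsumI)
  thus ?thesis using g' [of z] r by simp
qed

lemma infsum_mult_infsum:
  fixes f :: "'a \<Rightarrow> complex" and g :: "'b \<Rightarrow> complex"
  assumes "(\<lambda>x. norm (f x)) summable_on A" "(\<lambda>y. norm (g y)) summable_on B"
  shows "(\<lambda>(x, y). f x * g y) summable_on A \<times> B"
    and "(\<Sum>\<^sub>\<infinity>(x, y)\<in>A \<times> B. f x * g y) = (\<Sum>\<^sub>\<infinity>x\<in>A. f x) * (\<Sum>\<^sub>\<infinity>y\<in>B. g y)"
proof -
  have "(\<lambda>p. norm (case p of (x, y) \<Rightarrow> f x * g y)) summable_on A \<times> B"
    using assms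
    by (intro Infinite_Sum.abs_summable_on_Sigma_iff [THEN iffD2])
      (auto simp: norm_mult infsum_cmult_right' infsum_nonneg
        intro!: summable_on_cmult_right summable_on_cmult_left)
  thus s: "(\<lambda>(x, y). f x * g y) summable_on A \<times> B"
    by (rule abs_summable_summable)
  have "(\<Sum>\<^sub>\<infinity>(x, y)\<in>A \<times> B. f x * g y) = (\<Sum>\<^sub>\<infinity>x\<in>A. \<Sum>\<^sub>\<infinity>y\<in>B. f x * g y)"
    using infsum_Sigma_banach [OF s] by simp
  also have "\<dots> = (\<Sum>\<^sub>\<infinity>x\<in>A. f x) * (\<Sum>\<^sub>\<infinity>y\<in>B. g y)"
    by (simp add: infsum_cmult_right' infsum_cmult_left')
  finally show "(\<Sum>\<^sub>\<infinity>(x, y)\<in>A \<times> B. f x * g y) = (\<Sum>\<^sub>\<infinity>x\<in>A. f x) * (\<Sum>\<^sub>\<infinity>y\<in>B. g y)" .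
qed

lemma summable_on_intI:
  fixes f :: "int \<Rightarrow> 'a :: banach"
  assumes "(\<lambda>n. f (int n)) summable_on UNIV" "(\<lambda>n. f (- 1 - int n)) summable_on UNIV"
  shows "f summable_on UNIV"
proof -
  have "f summable_on range int"
    using assms(1) by (subst summable_on_reindex) (auto simp: o_def)
  moreover have "f summable_on range (\<lambda>n. - 1 - int n)"
    using assms(2) by (subst summable_on_reindex) (auto simp: o_def inj_def)
  ultimately have "f summable_on (range int \<union> range (\<lambda>n. - 1 - int n))"
    by (rule summable_on_Un_disjoint) auto
  also have "range int \<union> range (\<lambda>n. - 1 - int n) = UNIV"
  proof -
    have "n \<in> range int \<union> range (\<lambda>n. - 1 - int n)" for n
    proof (cases "n \<ge> 0")
      case True
      hence "n = int (nat n)" by simp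
      thus ?thesis by blast
    next
      case False
      hence "n = - 1 - int (nat (- 1 - n))" by simp
      thus ?thesis by blast
    qed
    thus ?thesis by blast
  qed
  finally show ?thesis .
qed

lemma summable_exp_neg_abs_int: "(\<lambda>n::int. exp (- real_of_int \<bar>n\<bar>)) summable_on UNIV"
proof -
  have geo: "(\<lambda>n. exp (-1) ^ n :: real) summable_on UNIV"
    by (rule summable_nonneg_imp_summable_on) (auto intro!: summable_geometric)
  have eq: "exp (- real n) = exp (-1) ^ n" for n
    by (simp add: exp_of_nat_mult [symmetric])
  have "exp (- real_of_int \<bar>- 1 - int n\<bar>) = exp (-1) * exp (-1) ^ n" for n
    by (simp add: eq [symmetric] exp_add [symmetric] algebra_simps)
  thus ?thesis
    using geo by (intro summable_on_intI) (auto simp: eq intro: summable_on_cmult_right)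
qed

section \<open>Theta functions with real characteristics\<close>

text \<open>The factor (2n+1+v)^k makes \<open>Psi k v s t\<close> the k-th s-derivative of
  Theta_v(s). For v = 0 this is, up to a constant factor, Jacobi's theta_1 with nome exp(4t) and s =
  iz. In general Theta_v(s) = exp(v^2 t + v s) Theta_0(s + 2vt), so a characteristic amounts to a
  translation of s.\<close>

definition Psi_term :: "nat \<Rightarrow> real \<Rightarrow> complex \<Rightarrow> complex \<Rightarrow> int \<Rightarrow> complex" where
  "Psi_term k v s t n = (-1) powi n * of_real (2 * of_int n + 1 + v) ^ k *
     exp (of_real (2 * of_int n + 1 + v) ^ 2 * t + of_real (2 * of_int n + 1 + v) * s)"

definition Psi :: "nat \<Rightarrow> real \<Rightarrow> complex \<Rightarrow> complex \<Rightarrow> complex" where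
  "Psi k v s t = (\<Sum>\<^sub>\<infinity>n. Psi_term k v s t n)"

text \<open>Completing the square bounds -d y^2 + (R+2)|y| by (R+2)^2/(4d), so a factor exp(-2|y|)
  is left over: one half absorbs |y|^k, the other gives summability over n. A single majorant serves
  a disc in s and a half-plane in t, as the two derivatives below require.\<close>

lemma Psi_term_bound:
  assumes "d > 0"
  obtains M where "M summable_on UNIV"
    "\<And>s t n. Re t \<le> - d \<Longrightarrow> norm s \<le> R \<Longrightarrow> norm (Psi_term k v s t n) \<le> M n"
proof
  define C where "C = fact k * exp ((R + 2)\<^sup>2 / (4 * d)) * exp (1 + \<bar>v\<bar>)"
  show "(\<lambda>n. C * exp (- real_of_int \<bar>n\<bar>)) summable_on UNIV"
    by (intro summable_on_cmult_right summable_exp_neg_abs_int)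
  fix s t :: complex and n :: int
  assume t: "Re t \<le> - d" and s: "norm s \<le> R"
  define y where "y = 2 * of_int n + 1 + v"
  have "norm (Psi_term k v s t n) = \<bar>y\<bar> ^ k * exp (y\<^sup>2 * Re t + y * Re s)"
    by (simp add: Psi_term_def y_def [symmetric] norm_mult norm_power norm_power_int power_abs
        flip: of_real_power)
  also have "\<dots> \<le> (fact k * exp \<bar>y\<bar>) * exp ((R + 2)\<^sup>2 / (4 * d) - 2 * \<bar>y\<bar>)"
  proof (intro mult_mono)
    have "\<bar>y\<bar> ^ k / fact k \<le> exp \<bar>y\<bar>"
      using sum_le_suminf [OF summable_exp_generic, of "{k}" "\<bar>y\<bar>"]
      by (simp add: exp_def divide_inverse mult.commute)
    thus "\<bar>y\<bar> ^ k \<le> fact k * exp \<bar>y\<bar>" by (simp add: field_simps)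
    have "y\<^sup>2 * Re t \<le> - d * \<bar>y\<bar>\<^sup>2"
      using mult_left_mono [OF t, of "y\<^sup>2"] by (simp add: mult_ac)
    moreover have "y * Re s \<le> R * \<bar>y\<bar>"
    proof -
      have "\<bar>Re s\<bar> \<le> R" using abs_Re_le_cmod [of s] s by linarith
      hence "\<bar>y * Re s\<bar> \<le> R * \<bar>y\<bar>"
        using mult_right_mono [of "\<bar>Re s\<bar>" R "\<bar>y\<bar>"] by (simp add: abs_mult mult.commute)
      thus ?thesis by linarith
    qed
    moreover have "- d * \<bar>y\<bar>\<^sup>2 + (R + 2) * \<bar>y\<bar> \<le> (R + 2)\<^sup>2 / (4 * d)"
    proof -
      have "0 \<le> (2 * d * \<bar>y\<bar> - (R + 2))\<^sup>2" by simp
      thus ?thesis using assms by (simp add: field_simps power2_eq_square)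
    qed
    ultimately show "exp (y\<^sup>2 * Re t + y * Re s) \<le> exp ((R + 2)\<^sup>2 / (4 * d) - 2 * \<bar>y\<bar>)"
      by (simp add: algebra_simps)
  qed auto
  also have "\<dots> = fact k * exp ((R + 2)\<^sup>2 / (4 * d)) * exp (- \<bar>y\<bar>)"
    by (simp add: mult_ac flip: exp_add)
  also have "\<dots> \<le> fact k * exp ((R + 2)\<^sup>2 / (4 * d)) * exp ((1 + \<bar>v\<bar>) - real_of_int \<bar>n\<bar>)"
    by (intro mult_left_mono) (auto simp: y_def)
  also have "\<dots> = C * exp (- real_of_int \<bar>n\<bar>)"
    by (simp add: C_def mult_ac flip: exp_add)
  finally show "norm (Psi_term k v s t n) \<le> C * exp (- real_of_int \<bar>n\<bar>)" .
qed

lemma abs_summable_Psi: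
  assumes "Re t < 0"
  shows "(\<lambda>n. norm (Psi_term k v s t n)) summable_on UNIV"
proof -
  obtain M where M: "M summable_on UNIV" "\<And>n. norm (Psi_term k v s t n) \<le> M n"
    using Psi_term_bound [of "- Re t" "norm s" k v] assms by (metis minus_minus neg_0_less_iff_less order_refl)
  show ?thesis by (rule summable_on_comparison_test [OF M(1)]) (use M(2) in auto)
qed

lemma DERIV_Psi_s:
  assumes "Re t < 0"
  shows "((\<lambda>s. Psi k v s t) has_field_derivative Psi (Suc k) v s t) (at s)"
proof -
  obtain M where M: "M summable_on UNIV"
    "\<And>w n. norm w \<le> norm s + 1 \<Longrightarrow> norm (Psi_term k v w t n) \<le> M n"
    using Psi_term_bound [of "- Re t" "norm s + 1" k v] assms
    by (metis minus_minus neg_0_less_iff_less order_refl)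
  have "((\<lambda>w. Psi_term k v w t n) has_field_derivative Psi_term (Suc k) v w t n) (at w)" for w n
    unfolding Psi_term_def by (rule derivative_eq_intros refl | simp)+
  moreover have "norm w \<le> norm s + 1" if "w \<in> cball s 1" for w
    using that norm_triangle_sub [of w s] by (simp add: dist_norm norm_minus_commute)
  ultimately show ?thesis
    unfolding Psi_def using M by (intro has_field_derivative_infsum_dominated [where r = 1]) auto
qed

lemma DERIV_Psi_t:
  assumes "Re t < 0"
  shows "((\<lambda>t. Psi k v s t) has_field_derivative Psi (Suc (Suc k)) v s t) (at t)"
proof -
  obtain M where M: "M summable_on UNIV"
    "\<And>w n. Re w \<le> Re t / 2 \<Longrightarrow> norm (Psi_term k v s w n) \<le> M n"
    using Psi_term_bound [of "- Re t / 2" "norm s" k v] assms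
    by (metis divide_minus_left half_gt_zero minus_minus neg_0_less_iff_less order_refl)
  have "((\<lambda>w. Psi_term k v s w n) has_field_derivative Psi_term (Suc (Suc k)) v s w n) (at w)" for w n
    unfolding Psi_term_def by (rule derivative_eq_intros refl | simp add: power2_eq_square)+
  moreover have "Re w \<le> Re t / 2" if "w \<in> cball t (- Re t / 2)" for w
    using that abs_Re_le_cmod [of "w - t"] by (simp add: dist_norm norm_minus_commute)
  ultimately show ?thesis
    unfolding Psi_def using M assms
    by (intro has_field_derivative_infsum_dominated [where r = "- Re t / 2"]) auto
qed

lemmas DERIV_Psi_s' [derivative_intros] = DERIV_chain2 [OF DERIV_Psi_s]

text \<open>Shifting n by one flips the sign (-1)^n. Together with the reflection in
  \<open>Psi_minus\<close> this folds all sums, differences and doubles of 2/7, 4/7, 6/7 met below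
  back onto 0, 2/7, 4/7, 6/7.\<close>

lemma Psi_add_2: "Psi k (v + 2) s t = - Psi k v s t"
proof -
  have "Psi k v s t = (\<Sum>\<^sub>\<infinity>n. Psi_term k v s t (n + 1))"
    unfolding Psi_def by (rule infsum_reindex_bij_witness [of _ "\<lambda>n. n + 1" "\<lambda>n. n - 1"]) auto
  also have "\<dots> = (\<Sum>\<^sub>\<infinity>n. - Psi_term k (v + 2) s t n)"
    by (rule infsum_cong) (simp add: Psi_term_def power_int_add algebra_simps)
  finally show ?thesis by (simp add: Psi_def infsum_uminus)
qed

lemma Psi_minus: "Psi k (- v) (- s) t = (-1) ^ Suc k * Psi k v s t"
proof -
  have "Psi k v s t = (\<Sum>\<^sub>\<infinity>n. Psi_term k v s t (- 1 - n))"
    unfolding Psi_def by (rule infsum_reindex_bij_witness [of _ "\<lambda>n. - 1 - n" "\<lambda>n. - 1 - n"]) auto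
  also have "\<dots> = (\<Sum>\<^sub>\<infinity>n. (-1) ^ Suc k * Psi_term k (- v) (- s) t n)"
  proof (rule infsum_cong)
    fix n :: int
    have sgn: "(-1) powi (- 1 - n) = - ((-1) powi n :: complex)"
      using power_int_minus_one_minus [of "1 + n", where 'a = complex] by (simp add: power_int_add)
    define y :: complex where "y = of_real (2 * of_int n + 1 + - v)"
    have y: "of_real (2 * of_int (- 1 - n) + 1 + v) = - y"
      by (simp add: y_def)
    have "Psi_term k (- v) (- s) t n = (-1) powi n * y ^ k * exp (y ^ 2 * t - y * s)"
      unfolding Psi_term_def y_def by simp
    thus "Psi_term k v s t (- 1 - n) = (-1) ^ Suc k * Psi_term k (- v) (- s) t n"
      unfolding Psi_term_def [of k v s] y sgn using power_minus [of y k] by simp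
  qed
  also have "\<dots> = (-1) ^ Suc k * Psi k (- v) (- s) t"
    by (simp only: Psi_def infsum_cmult_right')
  finally show ?thesis by (cases "even k") simp_all
qed

section \<open>Products of two theta functions and the three-term identity\<close>

definition Ups :: "real \<Rightarrow> complex \<Rightarrow> complex \<Rightarrow> complex" where
  "Ups v s t = (\<Sum>\<^sub>\<infinity>n::int. exp (2 * of_real (2 * of_int n + v) ^ 2 * t + 2 * of_real (2 * of_int n + v) * s))"

text \<open>For A = 2m+1+v+v' and B = 2n+1+v-v', the identity A^2 + B^2 = 2((A+B)/2)^2 +
  2((A-B)/2)^2 separates the exponent. The sign (-1)^(m+n) depends only on the parity class, so each
  class is a product of two unsigned series \<open>Ups\<close>. The result is the determinant of the
  vectors (\<open>Ups (v + 1) s t\<close>, \<open>Ups v s t\<close>) and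
  (\<open>Ups (v' + 1) s' t\<close>, \<open>Ups v' s' t\<close>).\<close>

lemma Psi_mult_Psi:
  assumes "Re t < 0"
  shows "Psi 0 (v + v') (s + s') t * Psi 0 (v - v') (s - s') t =
    Ups (v + 1) s t * Ups v' s' t - Ups v s t * Ups (v' + 1) s' t"
proof -
  define U where
    "U v s n = exp (2 * of_real (2 * of_int n + v) ^ 2 * t + 2 * of_real (2 * of_int n + v) * s)"
    for v s and n :: int
  have Ups: "Ups v s t = infsum (U v s) UNIV" for v s
    unfolding Ups_def U_def [abs_def] ..
  \<comment> \<open>Up to its sign, \<open>U v s n\<close> is a term of the series
    \<open>Psi 0 (v - 1)\<close> at 2s and 2t.\<close>
  have abs_U: "(\<lambda>n. norm (U v s n)) summable_on UNIV" for v s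
    using abs_summable_Psi [of "2 * t" 0 "v - 1" "2 * s"] assms
    by (simp add: U_def Psi_term_def norm_mult norm_power_int mult_ac)
  let ?f = "\<lambda>(m, n). Psi_term 0 (v + v') (s + s') t m * Psi_term 0 (v - v') (s - s') t n"
  \<comment> \<open>Half-sum and half-difference of two odd integers \<open>2 m + 1\<close>, \<open>2 n + 1\<close> have opposite parity;
    \<open>h1\<close> and \<open>h2\<close> parametrise the two cases.\<close>
  define h1 h2 :: "int \<times> int \<Rightarrow> int \<times> int"
    where "h1 = (\<lambda>(p, r). (p + r, p - r))" and "h2 = (\<lambda>(p, r). (p + r, p - r - 1))"
  have sf: "?f summable_on UNIV"
    using infsum_mult_infsum(1) [OF abs_summable_Psi abs_summable_Psi] assms by force
  have union: "range h1 \<union> range h2 = UNIV"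
  proof -
    have "(m, n) \<in> range h1 \<union> range h2" for m n
    proof (cases "even (m + n)")
      case True
      then obtain p where "m + n = 2 * p" by (elim evenE)
      hence "(m, n) = h1 (p, m - p)" by (simp add: h1_def)
      thus ?thesis by blast
    next
      case False
      then obtain p where "m + n = 2 * p + 1" by (elim oddE)
      hence "(m, n) = h2 (p + 1, m - p - 1)" by (simp add: h2_def)
      thus ?thesis by blast
    qed
    thus ?thesis by auto
  qed
  have disj: "range h1 \<inter> range h2 = {}"
  proof -
    have "h1 (p, r) \<noteq> h2 (p', r')" for p r p' r'
      unfolding h1_def h2_def by simp presburger
    thus ?thesis by (auto simp del: split_paired_All) (metis surj_pair)
  qed
  have inj: "inj h1" "inj h2" by (auto simp: inj_def h1_def h2_def)
  define E where "E v s n = of_real (2 * of_int n + 1 + v) ^ 2 * t + of_real (2 * of_int n + 1 + v) * s"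
    for v s and n :: int
  have f: "?f (m, n) = (-1) powi (m + n) * exp (E (v + v') (s + s') m + E (v - v') (s - s') n)" for m n
    by (simp add: Psi_term_def E_def power_int_add exp_add)
  have 1: "?f (h1 (p, r)) = U (v + 1) s p * U v' s' r" for p r
  proof -
    have "E (v + v') (s + s') (p + r) + E (v - v') (s - s') (p - r) =
        2 * of_real (2 * of_int p + (v + 1)) ^ 2 * t + 2 * of_real (2 * of_int p + (v + 1)) * s +
        (2 * of_real (2 * of_int r + v') ^ 2 * t + 2 * of_real (2 * of_int r + v') * s')"
      unfolding E_def of_real_add of_real_diff of_real_mult of_real_of_int_eq of_int_add of_int_diff
        of_real_numeral of_real_1
      by algebra
    moreover have "(-1) powi (p + r + (p - r)) = (1 :: complex)" by simp
    ultimately show ?thesis unfolding h1_def prod.case f [unfolded prod.case] U_def mult_exp_exp by simp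
  qed
  have 2: "?f (h2 (p, r)) = - (U v s p * U (v' + 1) s' r)" for p r
  proof -
    have "E (v + v') (s + s') (p + r) + E (v - v') (s - s') (p - r - 1) =
        2 * of_real (2 * of_int p + v) ^ 2 * t + 2 * of_real (2 * of_int p + v) * s +
        (2 * of_real (2 * of_int r + (v' + 1)) ^ 2 * t + 2 * of_real (2 * of_int r + (v' + 1)) * s')"
      unfolding E_def of_real_add of_real_diff of_real_mult of_real_of_int_eq of_int_add of_int_diff
        of_real_numeral of_real_1 of_int_1
      by algebra
    moreover have "(-1) powi (p + r + (p - r - 1)) = (- 1 :: complex)" by simp
    ultimately show ?thesis unfolding h2_def prod.case f [unfolded prod.case] U_def mult_exp_exp by simp
  qed
  have "Psi 0 (v + v') (s + s') t * Psi 0 (v - v') (s - s') t = (\<Sum>\<^sub>\<infinity>p\<in>UNIV \<times> UNIV. ?f p)"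
    unfolding Psi_def using assms by (intro infsum_mult_infsum(2) [symmetric] abs_summable_Psi)
  also have "\<dots> = (\<Sum>\<^sub>\<infinity>p\<in>range h1 \<union> range h2. ?f p)" by (simp add: union)
  also have "\<dots> = (\<Sum>\<^sub>\<infinity>p\<in>range h1. ?f p) + (\<Sum>\<^sub>\<infinity>p\<in>range h2. ?f p)"
    using disj by (intro infsum_Un_disjoint summable_on_subset [OF sf]) auto
  also have "(\<Sum>\<^sub>\<infinity>p\<in>range h1. ?f p) = (\<Sum>\<^sub>\<infinity>(p, r)\<in>UNIV \<times> UNIV. U (v + 1) s p * U v' s' r)"
    unfolding infsum_reindex [OF inj(1)] UNIV_Times_UNIV
    by (rule infsum_cong) (use 1 [of "fst x" "snd x" for x] in \<open>simp add: case_prod_unfold\<close>)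
  also have "\<dots> = Ups (v + 1) s t * Ups v' s' t"
    unfolding infsum_mult_infsum(2) [OF abs_U abs_U] by (simp only: Ups)
  also have "(\<Sum>\<^sub>\<infinity>p\<in>range h2. ?f p) = (\<Sum>\<^sub>\<infinity>p\<in>UNIV \<times> UNIV. - (case p of (p, r) \<Rightarrow> U v s p * U (v' + 1) s' r))"
    unfolding infsum_reindex [OF inj(2)] UNIV_Times_UNIV
    by (rule infsum_cong) (use 2 [of "fst x" "snd x" for x] in \<open>simp add: case_prod_unfold\<close>)
  also have "\<dots> = - (Ups v s t * Ups (v' + 1) s' t)"
    unfolding infsum_uminus infsum_mult_infsum(2) [OF abs_U abs_U] by (simp only: Ups)
  finally show ?thesis by simp
qed

text \<open>The Pluecker relation [AB][CD] - [AC][BD] + [AD][BC] = 0 for the plane vectors that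
  \<open>Psi_mult_Psi\<close> attaches to A = (v, s), B = (v', s'), C = (0, 0), D = (0, d). Oddness
  of Theta_0 turns [CD] into \<open>- Psi 0 0 d t ^ 2\<close>.\<close>

lemma Psi_three_term:
  assumes "Re t < 0"
  shows "Psi 0 (v + v') (s + s') t * Psi 0 (v - v') (s - s') t * Psi 0 0 d t ^ 2 =
    Psi 0 v' s' t ^ 2 * (Psi 0 v (s + d) t * Psi 0 v (s - d) t) -
    Psi 0 v s t ^ 2 * (Psi 0 v' (s' + d) t * Psi 0 v' (s' - d) t)"
proof -
  note W = Psi_mult_Psi [OF assms]
  have "Psi 0 0 (- d) t = - Psi 0 0 d t"
    using Psi_minus [of 0 0 d t] by simp
  hence d: "Psi 0 0 d t ^ 2 = - (Psi 0 (0 + 0) (0 + d) t * Psi 0 (0 - 0) (0 - d) t)"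
    by (simp add: power2_eq_square)
  have sq: "Psi 0 v s t ^ 2 = Psi 0 (v + 0) (s + 0) t * Psi 0 (v - 0) (s - 0) t" for v s
    by (simp add: power2_eq_square)
  have sd: "Psi 0 v (s + d) t * Psi 0 v (s - d) t = Psi 0 (v + 0) (s + d) t * Psi 0 (v - 0) (s - d) t" for v s
    by simp
  show ?thesis unfolding d [unfolded W] sq [unfolded W] sd [unfolded W] W by algebra
qed

text \<open>The second d-derivative of the three-term identity at d = 0; since Theta_0(0) = 0, only
  the square of \<open>Psi 1 0 0 t\<close> survives on the left. It is the counterpart of the
  sigma-function formula for a difference of two values of Weierstrass's wp.\<close>

lemma Psi_fundamental:
  assumes t: "Re t < 0"
  shows "Psi 1 0 0 t ^ 2 * (Psi 0 (v + v') (s + s') t * Psi 0 (v - v') (s - s') t) =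
    Psi 0 v' s' t ^ 2 * (Psi 0 v s t * Psi 2 v s t - Psi 1 v s t ^ 2) -
    Psi 0 v s t ^ 2 * (Psi 0 v' s' t * Psi 2 v' s' t - Psi 1 v' s' t ^ 2)"
proof -
  define K where "K = Psi 0 (v + v') (s + s') t * Psi 0 (v - v') (s - s') t"
  define L M where "L = Psi 0 v s t ^ 2" and "M = Psi 0 v' s' t ^ 2"
  \<comment> \<open>\<open>H\<close> is the three-term identity moved to one side, hence zero for
    all d, and so is its derivative \<open>H1\<close>. The factors \<open>K\<close>,
    \<open>L\<close>, \<open>M\<close> are constant in d.\<close>
  define H where "H d = K * Psi 0 0 d t ^ 2 - M * (Psi 0 v (s + d) t * Psi 0 v (s - d) t) +
    L * (Psi 0 v' (s' + d) t * Psi 0 v' (s' - d) t)" for d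
  define H1 where "H1 d = K * (2 * Psi 0 0 d t * Psi 1 0 d t) -
      M * (Psi 1 v (s + d) t * Psi 0 v (s - d) t - Psi 0 v (s + d) t * Psi 1 v (s - d) t) +
      L * (Psi 1 v' (s' + d) t * Psi 0 v' (s' - d) t - Psi 0 v' (s' + d) t * Psi 1 v' (s' - d) t)" for d
  have "H = (\<lambda>_. 0)"
    using Psi_three_term [OF t, of v v' s s'] by (simp add: H_def K_def L_def M_def fun_eq_iff)
  hence "(H has_field_derivative 0) (at d)" for d by simp
  moreover have "(H has_field_derivative H1 d) (at d)" for d
    unfolding H_def [abs_def] H1_def
    by (rule derivative_eq_intros refl t)+ (simp add: algebra_simps)
  ultimately have "H1 = (\<lambda>_. 0)" by (auto intro: DERIV_unique)
  hence "(H1 has_field_derivative 0) (at 0)" by simp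
  moreover have "(H1 has_field_derivative
      K * (2 * (Psi 1 0 0 t ^ 2 + Psi 0 0 0 t * Psi 2 0 0 t)) -
      M * (2 * (Psi 0 v s t * Psi 2 v s t - Psi 1 v s t ^ 2)) +
      L * (2 * (Psi 0 v' s' t * Psi 2 v' s' t - Psi 1 v' s' t ^ 2))) (at 0)"
    unfolding H1_def [abs_def]
    by (rule derivative_eq_intros refl t)+
      (simp add: numeral_2_eq_2 algebra_simps power2_eq_square)
  ultimately have "K * (2 * (Psi 1 0 0 t ^ 2 + Psi 0 0 0 t * Psi 2 0 0 t)) -
      M * (2 * (Psi 0 v s t * Psi 2 v s t - Psi 1 v s t ^ 2)) +
      L * (2 * (Psi 0 v' s' t * Psi 2 v' s' t - Psi 1 v' s' t ^ 2)) = 0"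
    by (auto intro: DERIV_unique)
  moreover have "Psi 0 0 0 t = 0" using Psi_minus [of 0 0 0 t] by simp
  ultimately have "(2 :: complex) * (Psi 1 0 0 t ^ 2 * K - (M * (Psi 0 v s t * Psi 2 v s t - Psi 1 v s t ^ 2) -
      L * (Psi 0 v' s' t * Psi 2 v' s' t - Psi 1 v' s' t ^ 2))) = 0"
    by (simp add: algebra_simps)
  hence "Psi 1 0 0 t ^ 2 * K - (M * (Psi 0 v s t * Psi 2 v s t - Psi 1 v s t ^ 2) -
      L * (Psi 0 v' s' t * Psi 2 v' s' t - Psi 1 v' s' t ^ 2)) = 0"
    by (subst (asm) mult_eq_0_iff) simp
  thus ?thesis unfolding K_def L_def M_def by (simp only: right_minus_eq)
qed

text \<open>Both sides are the s-derivative of the left side of \<open>Psi_fundamental\<close>, with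
  (v', s') held fixed.\<close>

lemma Psi_fundamental_deriv:
  assumes t: "Re t < 0"
  shows "Psi 1 0 0 t ^ 2 * (Psi 1 (v + v') (s + s') t * Psi 0 (v - v') (s - s') t +
      Psi 0 (v + v') (s + s') t * Psi 1 (v - v') (s - s') t) =
    Psi 0 v' s' t ^ 2 * (Psi 0 v s t * Psi 3 v s t - Psi 1 v s t * Psi 2 v s t) -
    2 * Psi 0 v s t * Psi 1 v s t * (Psi 0 v' s' t * Psi 2 v' s' t - Psi 1 v' s' t ^ 2)"
    (is "?l s = ?r s")
proof (rule DERIV_unique)
  show "((\<lambda>s. Psi 1 0 0 t ^ 2 * (Psi 0 (v + v') (s + s') t * Psi 0 (v - v') (s - s') t))
      has_field_derivative ?l s) (at s)"
    by (rule derivative_eq_intros refl t)+ (simp add: algebra_simps)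
  show "((\<lambda>s. Psi 1 0 0 t ^ 2 * (Psi 0 (v + v') (s + s') t * Psi 0 (v - v') (s - s') t))
      has_field_derivative ?r s) (at s)"
    unfolding Psi_fundamental [OF t]
    by (rule derivative_eq_intros refl t)+
      (simp add: numeral_2_eq_2 numeral_3_eq_3 algebra_simps power2_eq_square)
qed

text \<open>The case v' = v, s' = s of \<open>Psi_fundamental_deriv\<close>: the difference
  arguments become 0, where Theta_0 vanishes and its derivative supplies the third factor
  \<open>Psi 1 0 0 t\<close>.\<close>

lemma Psi_duplication:
  assumes t: "Re t < 0"
  shows "Psi 1 0 0 t ^ 3 * Psi 0 (2 * v) (2 * s) t =
    Psi 0 v s t ^ 3 * Psi 3 v s t - 3 * Psi 0 v s t ^ 2 * Psi 1 v s t * Psi 2 v s t +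
    2 * Psi 0 v s t * Psi 1 v s t ^ 3"
proof -
  have "Psi 0 0 0 t = 0" using Psi_minus [of 0 0 0 t] by simp
  thus ?thesis
    using Psi_fundamental_deriv [OF t, of v v s s] by simp algebra
qed

lemma Psi_duplication_deriv:
  assumes t: "Re t < 0"
  shows "2 * Psi 1 0 0 t ^ 3 * Psi 1 (2 * v) (2 * s) t =
    Psi 0 v s t ^ 3 * Psi 4 v s t - 3 * Psi 0 v s t ^ 2 * Psi 2 v s t ^ 2 + 2 * Psi 1 v s t ^ 4"
    (is "?l s = ?r s")
proof (rule DERIV_unique)
  show "((\<lambda>s. Psi 1 0 0 t ^ 3 * Psi 0 (2 * v) (2 * s) t) has_field_derivative ?l s) (at s)"
    by (rule derivative_eq_intros refl t)+ (simp add: algebra_simps)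
  show "((\<lambda>s. Psi 1 0 0 t ^ 3 * Psi 0 (2 * v) (2 * s) t) has_field_derivative ?r s) (at s)"
    unfolding Psi_duplication [OF t]
    by (rule derivative_eq_intros refl t)+
      (simp add: eval_nat_numeral algebra_simps)
qed

section \<open>The triple product identity\<close>

text \<open>The M-test makes the convergence of the partial sums uniform in n, so the limit over
  finite sets commutes with the limit along \<open>F\<close>.\<close>

lemma tannery_infsum:
  fixes f :: "'a \<Rightarrow> 'b \<Rightarrow> 'c :: banach"
  assumes lim: "\<And>k. k \<in> A \<Longrightarrow> (f k \<longlongrightarrow> g k) F"
    and le: "\<And>k n. k \<in> A \<Longrightarrow> norm (f k n) \<le> M k"
    and M: "M summable_on A" and F: "F \<noteq> bot"
  shows "((\<lambda>n. \<Sum>\<^sub>\<infinity>k\<in>A. f k n) \<longlongrightarrow> (\<Sum>\<^sub>\<infinity>k\<in>A. g k)) F"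
proof (rule swap_uniform_limit')
  have "norm (g k) \<le> M k" if "k \<in> A" for k
    using tendsto_upperbound [OF tendsto_norm [OF lim [OF that]] always_eventually F] le [OF that] by blast
  hence "g summable_on A"
    by (intro abs_summable_summable [OF summable_on_comparison_test [OF M]]) auto
  thus "((\<lambda>X. \<Sum>k\<in>X. g k) \<longlongrightarrow> (\<Sum>\<^sub>\<infinity>k\<in>A. g k)) (finite_subsets_at_top A)"
    by (rule infsum_tendsto)
  show "\<forall>\<^sub>F X in finite_subsets_at_top A. ((\<lambda>n. \<Sum>k\<in>X. f k n) \<longlongrightarrow> (\<Sum>k\<in>X. g k)) F"
    by (rule eventually_finite_subsets_at_top_weakI) (auto intro!: tendsto_sum lim)
  show "uniform_limit UNIV (\<lambda>X n. \<Sum>k\<in>X. f k n) (\<lambda>n. \<Sum>\<^sub>\<infinity>k\<in>A. f k n) (finite_subsets_at_top A)"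
    by (rule Weierstrass_m_test_general [OF _ M]) (use le in auto)
qed auto

section \<open>Gaussian binomial coefficients and the finite triple product\<close>

fun qbinom :: "'a :: comm_ring_1 \<Rightarrow> nat \<Rightarrow> nat \<Rightarrow> 'a" where
  "qbinom q n 0 = 1"
| "qbinom q 0 (Suc k) = 0"
| "qbinom q (Suc n) (Suc k) = qbinom q n k + q ^ Suc k * qbinom q n (Suc k)"

lemma qbinom_eq_0: "n < k \<Longrightarrow> qbinom q n k = 0"
  by (induction q n k rule: qbinom.induct) auto

lemma Suc_choose_two: "Suc k choose 2 = (k choose 2) + k"
  by (simp add: numeral_2_eq_2)

text \<open>Splitting off 1 + x leaves the same product at x q, which is why the induction varies x.
  Comparing coefficients of x^(k+1) is then the Pascal rule that defines
  \<open>qbinom\<close>.\<close>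

lemma q_binomial_theorem:
  "(\<Prod>k<n. 1 + x * q ^ k) = (\<Sum>k\<le>n. qbinom q n k * q ^ (k choose 2) * x ^ k)"
proof (induction n arbitrary: x)
  case 0
  show ?case by (simp add: numeral_2_eq_2)
next
  case (Suc n)
  define b where "b k = qbinom q n k * q ^ (k choose 2) * (x * q) ^ k" for k
  define S where "S = (\<Sum>k\<le>n. b k)"
  have "(\<Prod>k<Suc n. 1 + x * q ^ k) = (1 + x) * (\<Prod>k<n. 1 + (x * q) * q ^ k)"
    by (simp add: prod.lessThan_Suc_shift mult_ac del: prod.lessThan_Suc)
  also have "\<dots> = S + x * S"
    by (simp only: Suc.IH b_def S_def distrib_right mult_1)
  also have "S + x * S = 1 + (\<Sum>k\<le>n. b (Suc k) + x * b k)"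
  proof -
    have "S = (\<Sum>k\<le>Suc n. b k)"
      by (simp add: S_def b_def qbinom_eq_0)
    also have "\<dots> = 1 + (\<Sum>k\<le>n. b (Suc k))"
      by (subst sum.atMost_Suc_shift) (simp add: b_def numeral_2_eq_2)
    finally have "S + x * S = 1 + ((\<Sum>k\<le>n. b (Suc k)) + x * S)" by simp
    thus ?thesis by (simp only: S_def sum.distrib sum_distrib_left)
  qed
  also have "(\<Sum>k\<le>n. b (Suc k) + x * b k) =
      (\<Sum>k\<le>n. qbinom q (Suc n) (Suc k) * q ^ (Suc k choose 2) * x ^ Suc k)"
    by (rule sum.cong) (simp_all add: b_def Suc_choose_two power_add power_mult_distrib algebra_simps)
  also have "1 + \<dots> = (\<Sum>k\<le>Suc n. qbinom q (Suc n) k * q ^ (k choose 2) * x ^ k)"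
    unfolding sum.atMost_Suc_shift [of _ n] by (simp add: numeral_2_eq_2 del: qbinom.simps(3))
  finally show ?case .
qed

definition qfac :: "'a :: comm_ring_1 \<Rightarrow> nat \<Rightarrow> 'a" where
  "qfac q n = (\<Prod>k<n. 1 - q ^ Suc k)"

lemma qfac_Suc: "qfac q (Suc n) = qfac q n * (1 - q ^ Suc n)"
  by (simp add: qfac_def)

lemma qbinom_mult_qfac:
  fixes q :: "'a :: idom"
  shows "k \<le> n \<Longrightarrow> qbinom q n k * (qfac q k * qfac q (n - k)) = qfac q n"
proof (induction q n k rule: qbinom.induct)
  case (3 q n k)
  show ?case
  proof (cases "k = n")
    case True
    have "qfac q 0 = 1" by (simp add: qfac_def)
    hence "qbinom q n n * qfac q n = qfac q n" using 3(1) True by simp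
    hence "qbinom q n n * (qfac q n * (1 - q * q ^ n)) = qfac q n * (1 - q * q ^ n)"
      by (simp only: mult.assoc [symmetric])
    thus ?thesis using True \<open>qfac q 0 = 1\<close> by (simp add: qbinom_eq_0 qfac_Suc)
  next
    case False
    hence "k < n" using 3(3) by simp
    then obtain m where m: "n = k + Suc m" using less_imp_Suc_add by auto
    have "qbinom q n k * (qfac q k * qfac q (Suc m)) = qfac q n"
      "qbinom q n (Suc k) * (qfac q (Suc k) * qfac q m) = qfac q n"
      using 3(1,2) m by auto
    moreover have e: "Suc n - Suc k = Suc m" "q ^ Suc n = q ^ Suc k * q ^ Suc m"
      using m by (simp_all add: power_add)
    \<comment> \<open>Here p = q^(k+1) and r = q^(m+1); the two Pascal summands combine through (1 -
      p) h + p (1 - r) h = (1 - p r) h.\<close>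
    moreover have "a * (f * (g * (1 - r))) = h \<Longrightarrow> b * (f * (1 - p) * g) = h \<Longrightarrow>
        (a + p * b) * (f * (1 - p) * (g * (1 - r))) = h * (1 - p * r)" for a b f g h p r :: 'a
    proof -
      have "(a + p * b) * (f * (1 - p) * (g * (1 - r))) =
          (1 - p) * (a * (f * (g * (1 - r)))) + p * (1 - r) * (b * (f * (1 - p) * g))"
        by (simp add: algebra_simps)
      thus "a * (f * (g * (1 - r))) = h \<Longrightarrow> b * (f * (1 - p) * g) = h \<Longrightarrow> ?thesis"
        by (simp add: algebra_simps)
    qed
    ultimately show ?thesis unfolding qbinom.simps qfac_Suc e by blast
  qed
qed (auto simp: qfac_def)

lemma prod_lessThan_add:
  fixes f :: "nat \<Rightarrow> 'a :: comm_monoid_mult"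
  shows "(\<Prod>k<m + n. f k) = (\<Prod>k<m. f k) * (\<Prod>k<n. f (k + m))"
  by (induction n) (simp_all add: mult.assoc add.commute)

text \<open>The q-binomial theorem with 2N factors at x = -u/q^N: the upper N factors are 1 - u q^k;
  the lower ones, read backwards, are 1 - (q/u) q^k times monomials whose product is
  \<open>c\<close>. The summation index is recentred by n = k - N.\<close>

lemma finite_triple_product:
  fixes q u :: "'a :: field"
  assumes "q \<noteq> 0" "u \<noteq> 0"
  shows "(\<Prod>k<N. 1 - u * q ^ k) * (\<Prod>k<N. 1 - q / u * q ^ k) =
    (\<Sum>n = - int N..int N. (-1) powi n * qbinom q (2 * N) (nat (n + int N)) *
      q powi (n * (n - 1) div 2) * u powi n)"
proof -
  define x where "x = - u / q ^ N"
  define c where "c = (- u) ^ N / q ^ (Suc N choose 2)"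
  have c: "(\<Prod>k<N. - u / q ^ Suc k) = c"
    unfolding c_def
  proof (induction N)
    case (Suc N)
    have "q ^ (Suc (Suc N) choose 2) = q ^ (Suc N choose 2) * q ^ Suc N"
      unfolding Suc_choose_two [of "Suc N"] by (rule power_add)
    thus ?case by (simp only: prod.lessThan_Suc Suc) simp
  qed (simp add: numeral_2_eq_2)
  have c0: "c \<noteq> 0" using assms by (simp add: c_def)
  have "(\<Prod>k<N + N. 1 + x * q ^ k) = (\<Prod>k<N. 1 + x * q ^ k) * (\<Prod>k<N. 1 + x * q ^ (k + N))"
    by (rule prod_lessThan_add)
  also have "(\<Prod>k<N. 1 + x * q ^ (k + N)) = (\<Prod>k<N. 1 - u * q ^ k)"
    using assms by (intro prod.cong) (simp_all add: x_def power_add)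
  also have "(\<Prod>k<N. 1 + x * q ^ k) = (\<Prod>k<N. 1 + x * q ^ (N - Suc k))"
    by (rule prod.nat_diff_reindex [symmetric])
  also have "\<dots> = (\<Prod>k<N. (- u / q ^ Suc k) * (1 - q / u * q ^ k))"
  proof (rule prod.cong)
    fix k assume "k \<in> {..<N}"
    hence "q ^ N = q ^ (N - Suc k) * q ^ Suc k"
      using power_add [of q "N - Suc k" "Suc k"] by simp
    thus "1 + x * q ^ (N - Suc k) = (- u / q ^ Suc k) * (1 - q / u * q ^ k)"
      using assms by (simp add: x_def field_simps)
  qed auto
  also have "\<dots> = c * (\<Prod>k<N. 1 - q / u * q ^ k)"
    by (simp only: prod.distrib c)
  finally have "(\<Prod>k<2 * N. 1 + x * q ^ k) =
      c * (\<Prod>k<N. 1 - q / u * q ^ k) * (\<Prod>k<N. 1 - u * q ^ k)"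
    unfolding mult_2 .
  moreover have "A * B = L / c" if "L = c * B * A" for A B L
    using c0 that by simp
  ultimately have "(\<Prod>k<N. 1 - u * q ^ k) * (\<Prod>k<N. 1 - q / u * q ^ k) =
      (\<Prod>k<2 * N. 1 + x * q ^ k) / c"
    by blast
  also have "\<dots> = (\<Sum>k\<le>2 * N. qbinom q (2 * N) k * q ^ (k choose 2) * x ^ k / c)"
    by (simp add: q_binomial_theorem sum_divide_distrib)
  also have "\<dots> = (\<Sum>n = - int N..int N. (-1) powi n * qbinom q (2 * N) (nat (n + int N)) *
      q powi (n * (n - 1) div 2) * u powi n)"
  proof (rule sum.reindex_bij_witness [of _ "\<lambda>n. nat (n + int N)" "\<lambda>k. int k - int N"])
    fix k assume "k \<in> {..2 * N}"
    define n where "n = int k - int N"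
    have two: "2 * int (m choose 2) = int m * (int m - 1)" for m
      by (induction m) (simp_all add: Suc_choose_two algebra_simps numeral_2_eq_2)
    \<comment> \<open>The three contributions to the exponent of q come from the q-binomial theorem,
      from x^k and from division by \<open>c\<close>.\<close>
    have "2 * (int (k choose 2) - int N * int k + int (Suc N choose 2)) = n * (n - 1)"
      unfolding right_diff_distrib distrib_left two by (simp add: n_def algebra_simps)
    hence "n * (n - 1) div 2 = int (k choose 2) - int N * int k + int (Suc N choose 2)"
      by simp
    hence B: "q powi (n * (n - 1) div 2) = q ^ (k choose 2) / (q ^ N) ^ k * q ^ (Suc N choose 2)"
      using assms by (simp add: power_int_add power_int_diff power_int_mult flip: power_mult of_nat_mult)
    have A: "(-1) powi n * u powi n = (- u) ^ k / (- u) ^ N"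
    proof -
      have "(-1) powi n * u powi n = (- u) powi n" by (simp flip: power_int_mult_distrib)
      thus ?thesis using assms by (simp add: n_def power_int_diff)
    qed
    have "(-1) powi n * qbinom q (2 * N) (nat (n + int N)) * q powi (n * (n - 1) div 2) * u powi n =
        qbinom q (2 * N) k * ((-1) powi n * u powi n) * q powi (n * (n - 1) div 2)"
      by (simp add: n_def mult_ac)
    also have "\<dots> = qbinom q (2 * N) k * q ^ (k choose 2) * x ^ k / c"
      unfolding A B x_def c_def power_divide by (simp add: field_simps)
    finally show "(-1) powi (int k - int N) * qbinom q (2 * N) (nat (int k - int N + int N)) *
        q powi ((int k - int N) * (int k - int N - 1) div 2) * u powi (int k - int N) =
        qbinom q (2 * N) k * q ^ (k choose 2) * x ^ k / c"
      unfolding n_def .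
  qed auto
  finally show ?thesis .
qed

section \<open>Infinite q-products and the limit of the finite identity\<close>

lemma norm_power_Suc_less_1:
  fixes q :: "'a :: real_normed_div_algebra"
  assumes "norm q < 1"
  shows "norm (q ^ Suc k) < 1"
  using assms power_decreasing [of 1 "Suc k" "norm q"] by (simp add: norm_power norm_mult)

lemma summable_norm_qpow:
  assumes "norm (q :: complex) < 1"
  shows "summable (\<lambda>k. norm (a * q ^ k))"
  using assms by (simp add: norm_mult norm_power summable_mult summable_geometric)

lemma convergent_qpoch:
  assumes "norm q < 1"
  shows "convergent_prod (\<lambda>k. 1 - a * q ^ k :: complex)"
  using summable_norm_qpow [OF assms, of a]
  by (intro abs_convergent_prod_imp_convergent_prod) (simp add: abs_convergent_prod_conv_summable)

lemma qpoch_inf_LIMSEQ: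
  assumes "norm q < 1"
  shows "(\<lambda>n. \<Prod>k<n. 1 - a * q ^ k) \<longlonglongrightarrow> qpoch_inf a q"
  using convergent_prod_LIMSEQ [OF convergent_qpoch [OF assms]]
  by (simp add: qpoch_inf_def LIMSEQ_lessThan_iff_atMost)

lemma qpoch_inf_eq_0_iff:
  assumes "norm q < 1"
  shows "qpoch_inf a q = 0 \<longleftrightarrow> (\<exists>k. a * q ^ k = 1)"
proof
  assume "qpoch_inf a q = 0"
  thus "\<exists>k. a * q ^ k = 1"
    using prodinf_nonzero [OF convergent_qpoch [OF assms, of a]] by (auto simp: qpoch_inf_def)
next
  assume "\<exists>k. a * q ^ k = 1"
  hence "\<exists>k. 1 - a * q ^ k = 0" by simp
  hence "(\<lambda>n. \<Prod>k\<le>n. 1 - a * q ^ k) \<longlonglongrightarrow> 0"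
    using convergent_prod_to_zero_iff [OF convergent_qpoch [OF assms, of a]] by blast
  thus "qpoch_inf a q = 0"
    using convergent_prod_LIMSEQ [OF convergent_qpoch [OF assms, of a]] LIMSEQ_unique
    unfolding qpoch_inf_def by blast
qed

lemma qpoch_inf_self_nonzero:
  assumes "norm q < 1"
  shows "qpoch_inf q q \<noteq> 0"
  using norm_power_Suc_less_1 [OF assms]
  by (metis assms norm_one order_less_irrefl power_Suc qpoch_inf_eq_0_iff)

lemma qpoch_inf_split_head:
  assumes "norm q < 1"
  shows "qpoch_inf a q = (1 - a) * qpoch_inf (a * q) q"
proof (rule LIMSEQ_unique)
  show "(\<lambda>n. \<Prod>k<Suc n. 1 - a * q ^ k) \<longlonglongrightarrow> qpoch_inf a q"
    using qpoch_inf_LIMSEQ [OF assms] by (rule LIMSEQ_Suc)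
  show "(\<lambda>n. \<Prod>k<Suc n. 1 - a * q ^ k) \<longlonglongrightarrow> (1 - a) * qpoch_inf (a * q) q"
    using tendsto_mult_left [OF qpoch_inf_LIMSEQ [OF assms, of "a * q"], of "1 - a"]
    by (simp add: prod.lessThan_Suc_shift mult_ac del: prod.lessThan_Suc)
qed

text \<open>Comparison with a geometric series makes the product uniform in a on discs. The
  continuity is what allows s to tend to 0 in \<open>jacobi_cube\<close>.\<close>

lemma continuous_on_qpoch_inf:
  assumes "norm q < 1"
  shows "continuous_on (cball 0 r) (\<lambda>a. qpoch_inf a q)"
proof -
  have "uniformly_convergent_on (cball 0 r) (\<lambda>N a. \<Prod>n<N. 1 - a * q ^ n)"
  proof (rule uniformly_convergent_on_prod')
    have "norm (norm (1 - a * q ^ n - 1)) \<le> norm (of_real r * q ^ n)" if "a \<in> cball 0 r" for a n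
      using that by (simp add: norm_mult mult_right_mono)
    thus "uniformly_convergent_on (cball 0 r) (\<lambda>N a. \<Sum>n<N. norm (1 - a * q ^ n - 1))"
      by (rule Weierstrass_m_test' [OF _ summable_norm_qpow [OF assms]])
  qed (intro continuous_intros compact_cball)+
  then obtain l where l: "uniform_limit (cball 0 r) (\<lambda>N a. \<Prod>n<N. 1 - a * q ^ n) l sequentially"
    by (auto simp: uniformly_convergent_on_def)
  have "continuous_on (cball 0 r) l"
    by (rule uniform_limit_theorem [OF _ l]) (intro always_eventually allI continuous_intros, simp)
  moreover have "l a = qpoch_inf a q" if "a \<in> cball 0 r" for a
    using tendsto_uniform_limitI [OF l that] qpoch_inf_LIMSEQ [OF assms] LIMSEQ_unique by blast
  ultimately show ?thesis by (rule continuous_on_eq)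
qed

lemma qfac_LIMSEQ:
  assumes "norm (q :: complex) < 1"
  shows "qfac q \<longlonglongrightarrow> qpoch_inf q q"
  using qpoch_inf_LIMSEQ [OF assms, of q] by (simp add: qfac_def [abs_def])

text \<open>The limit of \<open>finite_triple_product\<close>: the coefficient (q;q)_(2N) /
  ((q;q)_(N+n) (q;q)_(N-n)) tends to 1/(q;q)_inf, and it is bounded uniformly in n and N because
  (q;q)_n and its inverse both converge. Tannery's theorem then applies.\<close>

lemma triple_product:
  fixes q u :: complex
  assumes q: "norm q < 1" "q \<noteq> 0" and u: "u \<noteq> 0"
    and summable: "(\<lambda>n. norm ((-1) powi n * q powi (n * (n - 1) div 2) * u powi n)) summable_on UNIV"
  shows "qpoch_inf q q * qpoch_inf u q * qpoch_inf (q / u) q =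
    (\<Sum>\<^sub>\<infinity>n. (-1) powi n * q powi (n * (n - 1) div 2) * u powi n)"
proof -
  define c where "c n = (-1) powi n * q powi (n * (n - 1) div 2) * u powi n" for n
  have "q ^ Suc k \<noteq> 1" for k
    using norm_power_Suc_less_1 [OF q(1), of k] by auto
  hence qfac0: "qfac q n \<noteq> 0" for n
    by (auto simp: qfac_def)
  note qq0 = qpoch_inf_self_nonzero [OF q(1)]
  obtain C1 where C1: "norm (qfac q n) \<le> C1" for n
    using convergent_imp_Bseq [OF convergentI [OF qfac_LIMSEQ [OF q(1)]]] by (auto simp: Bseq_def)
  obtain C2 where C2: "norm (inverse (qfac q n)) \<le> C2" for n
    using convergent_imp_Bseq [OF convergentI [OF tendsto_inverse [OF qfac_LIMSEQ [OF q(1)] qq0]]]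
    by (auto simp: Bseq_def)
  have C0: "C1 \<ge> 0" "C2 \<ge> 0" using C1 [of 0] C2 [of 0] norm_ge_zero order_trans by blast+
  define f where "f n N = (if n \<in> {- int N..int N} then qbinom q (2 * N) (nat (n + int N)) * c n else 0)"
    for n and N :: nat
  have f: "f n N = qfac q (2 * N) * inverse (qfac q (nat (n + int N))) *
      inverse (qfac q (nat (int N - n))) * c n" if "n \<in> {- int N..int N}" for n N
  proof -
    have "2 * N - nat (n + int N) = nat (int N - n)" "nat (n + int N) \<le> 2 * N"
      using that by auto
    thus ?thesis
      using that qbinom_mult_qfac [of "nat (n + int N)" "2 * N" q] qfac0 by (simp add: f_def field_simps)
  qed
  have "(\<lambda>N. \<Sum>\<^sub>\<infinity>n. f n N) \<longlonglongrightarrow> (\<Sum>\<^sub>\<infinity>n. inverse (qpoch_inf q q) * c n)"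
  proof (rule tannery_infsum)
    show "(\<lambda>n. C1 * C2 * C2 * norm (c n)) summable_on UNIV"
      using summable by (intro summable_on_cmult_right) (simp add: c_def)
    show "norm (f n N) \<le> C1 * C2 * C2 * norm (c n)" for n N
    proof (cases "n \<in> {- int N..int N}")
      case True
      show ?thesis unfolding f [OF True] norm_mult
        by (intro mult_mono C1 C2 order_refl mult_nonneg_nonneg norm_ge_zero C0)
    qed (auto simp: f_def C0)
    show "f n \<longlonglongrightarrow> inverse (qpoch_inf q q) * c n" for n
    proof -
      have "filterlim (\<lambda>N. 2 * N) sequentially sequentially"
        by (rule filterlim_subseq) (auto simp: strict_mono_def)
      moreover have "filterlim (\<lambda>N. nat (int N + i)) sequentially sequentially" for i
        by (rule filterlim_at_top_mono [OF filterlim_minus_const_nat_at_top [of "nat \<bar>i\<bar>"]])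
          (intro always_eventually allI, linarith)
      from this [of n] this [of "- n"] have "filterlim (\<lambda>N. nat (n + int N)) sequentially sequentially"
        "filterlim (\<lambda>N. nat (int N - n)) sequentially sequentially" by (simp_all add: add.commute)
      ultimately have "(\<lambda>N. qfac q (2 * N) * inverse (qfac q (nat (n + int N))) *
          inverse (qfac q (nat (int N - n))) * c n) \<longlonglongrightarrow>
          qpoch_inf q q * inverse (qpoch_inf q q) * inverse (qpoch_inf q q) * c n"
        by (intro tendsto_mult tendsto_inverse tendsto_const qq0 filterlim_compose [OF qfac_LIMSEQ [OF q(1)]])
      moreover have "\<forall>\<^sub>F N in sequentially. f n N = qfac q (2 * N) * inverse (qfac q (nat (n + int N))) *
          inverse (qfac q (nat (int N - n))) * c n"
        using eventually_ge_at_top [of "nat \<bar>n\<bar>"] by eventually_elim (rule f, auto)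
      ultimately show ?thesis using qq0 by (simp add: tendsto_cong)
    qed
  qed auto
  moreover have "(\<Sum>\<^sub>\<infinity>n. f n N) = (\<Prod>k<N. 1 - u * q ^ k) * (\<Prod>k<N. 1 - q / u * q ^ k)" for N
  proof -
    have "(\<Sum>\<^sub>\<infinity>n. f n N) = (\<Sum>\<^sub>\<infinity>n\<in>{- int N..int N}. f n N)"
      by (rule infsum_cong_neutral) (auto simp: f_def)
    also have "\<dots> = (\<Sum>n = - int N..int N. f n N)" by simp
    also have "\<dots> = (\<Prod>k<N. 1 - u * q ^ k) * (\<Prod>k<N. 1 - q / u * q ^ k)"
      unfolding finite_triple_product [OF q(2) u] by (rule sum.cong) (auto simp: f_def c_def)
    finally show ?thesis .
  qed
  moreover have "(\<lambda>N. (\<Prod>k<N. 1 - u * q ^ k) * (\<Prod>k<N. 1 - q / u * q ^ k)) \<longlonglongrightarrow>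
      qpoch_inf u q * qpoch_inf (q / u) q"
    by (intro tendsto_mult qpoch_inf_LIMSEQ q)
  ultimately have "qpoch_inf u q * qpoch_inf (q / u) q = inverse (qpoch_inf q q) * (\<Sum>\<^sub>\<infinity>n. c n)"
    by (simp add: infsum_cmult_right' LIMSEQ_unique)
  thus ?thesis using qq0 by (simp add: c_def field_simps)
qed

section \<open>Product form of the theta functions: zeros and the derivative at 0\<close>

lemma Psi_triple_product:
  fixes t s :: complex and v :: real
  defines "q \<equiv> exp (8 * t)" and "u \<equiv> exp (8 * t + 4 * of_real v * t + 2 * s)"
  assumes t: "Re t < 0"
  shows "Psi 0 v s t = exp (of_real (1 + v) ^ 2 * t + of_real (1 + v) * s) *
    (qpoch_inf q q * qpoch_inf u q * qpoch_inf (q / u) q)"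
proof -
  define c where "c = exp (of_real (1 + v) ^ 2 * t + of_real (1 + v) * s)"
  define g where "g n = (-1) powi n * q powi (n * (n - 1) div 2) * u powi n" for n
  \<comment> \<open>The term n = 0 is \<open>c\<close>; relative to it the exponent is 4n(n-1)t +
    n(8t + 4vt + 2s), that is, q^(n(n-1)/2) u^n.\<close>
  have Psi_term: "Psi_term 0 v s t n = c * g n" for n
  proof -
    have "even (n * (n - 1))" by simp
    hence "2 * (n * (n - 1) div 2) = n * (n - 1)" by simp
    hence "2 * (of_int (n * (n - 1) div 2) :: complex) = of_int n * (of_int n - 1)"
      by (metis of_int_1 of_int_diff of_int_mult of_int_numeral)
    hence tri: "of_int (n * (n - 1) div 2) * (8 * t) = 4 * (of_int n * (of_int n - 1)) * t"
      by algebra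
    have "(2 * n + 1 + v)\<^sup>2 * t + (2 * n + 1 + v) * s = (1 + v)\<^sup>2 * t + (1 + v) * s +
        4 * (n * (n - 1)) * t + n * (8 * t + 4 * v * t + 2 * s)" for n v :: complex
      by algebra
    note this [of "of_int n" "of_real v"]
    thus ?thesis
      unfolding Psi_term_def c_def g_def q_def u_def exp_power_int tri of_real_add of_real_mult
        of_real_of_int_eq of_real_numeral of_real_1
      by (simp only: exp_add power_0 mult_1 mult_1_right mult_ac)
  qed
  have "(\<lambda>n. norm (inverse c) * norm (Psi_term 0 v s t n)) summable_on UNIV"
    by (intro summable_on_cmult_right abs_summable_Psi t)
  moreover have "norm (inverse c) * norm (Psi_term 0 v s t n) = norm (g n)" for n
    by (simp add: Psi_term norm_mult c_def norm_inverse)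
  ultimately have "(\<lambda>n. norm (g n)) summable_on UNIV" by simp
  hence "qpoch_inf q q * qpoch_inf u q * qpoch_inf (q / u) q = (\<Sum>\<^sub>\<infinity>n. g n)"
    unfolding g_def by (intro triple_product) (use t in \<open>auto simp: q_def u_def\<close>)
  thus ?thesis
    unfolding Psi_def Psi_term c_def [symmetric] by (simp add: infsum_cmult_right')
qed

text \<open>Every factor of the triple product has the form 1 - exp(r t) with r real, namely r =
  8+8k, 8+4v+8k or 8k-4v. For 0 < v < 2 no such r is 0, and then |exp(r t)| differs from 1.\<close>

lemma Psi_nonzero:
  assumes t: "Re t < 0" and v: "0 < v" "v < 2"
  shows "Psi 0 v 0 t \<noteq> 0"
proof -
  define q where "q = exp (8 * t)"
  define u where "u = exp (8 * t + 4 * of_real v * t + 2 * 0)"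
  have q: "norm q < 1" using t by (simp add: q_def)
  have exp_ne_1: "exp (of_real r * t) \<noteq> 1" if "r \<noteq> 0" for r
  proof -
    have "norm (exp (of_real r * t)) \<noteq> 1" using that t by (simp add: norm_exp_eq_Re)
    thus ?thesis by (metis norm_one)
  qed
  have "q * q ^ k = exp (of_real (8 + 8 * real k) * t)" for k
    by (simp add: q_def ring_distribs exp_add mult_ac flip: exp_of_nat_mult)
  hence "q * q ^ k \<noteq> 1" for k
    using exp_ne_1 [of "8 + 8 * real k"] by (metis add_nonneg_eq_0_iff mult_nonneg_nonneg of_nat_0_le_iff zero_le_numeral zero_neq_numeral)
  moreover have "u * q ^ k = exp (of_real (8 + 4 * v + 8 * real k) * t)" for k
    by (simp add: q_def u_def ring_distribs exp_add mult_ac flip: exp_of_nat_mult)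
  hence "u * q ^ k \<noteq> 1" for k
    using exp_ne_1 [of "8 + 4 * v + 8 * real k"] v by (smt (verit) of_nat_0_le_iff)
  moreover have e: "q / u * q ^ k = exp (of_real (8 * real k - 4 * v) * t)" for k
    by (simp add: q_def u_def ring_distribs exp_add exp_diff mult_ac divide_simps flip: exp_of_nat_mult)
  have "q / u * q ^ k \<noteq> 1" for k
  proof -
    have "8 * real k - 4 * v \<noteq> 0"
    proof (cases "k = 0")
      case False
      hence "real k \<ge> 1" by simp
      thus ?thesis using v by linarith
    qed (use v in simp)
    thus ?thesis unfolding e by (rule exp_ne_1)
  qed
  ultimately show ?thesis
    unfolding Psi_triple_product [OF t, of v 0, folded q_def u_def]
    using q by (auto simp: qpoch_inf_eq_0_iff)
qed

text \<open>The product for Theta_0(s) contains the factor 1 - exp(-2s), which vanishes at s = 0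
  with derivative 2. The cofactor \<open>g\<close> is continuous, and its value at 0 is exp t times
  the cube of the Euler product.\<close>

lemma jacobi_cube:
  assumes t: "Re t < 0"
  defines "q \<equiv> exp (8 * t)"
  shows "Psi 1 0 0 t = 2 * exp t * qpoch_inf q q ^ 3"
proof -
  have q: "norm q < 1" using t by (simp add: q_def)
  define g where "g s = exp (t + s) * (qpoch_inf q q * qpoch_inf (q * exp (2 * s)) q * qpoch_inf (q * exp (- 2 * s)) q)" for s
  have Psi_eq: "Psi 0 0 s t = (1 - exp (- 2 * s)) * g s" for s
  proof -
    have "q \<noteq> 0" unfolding q_def by (rule exp_not_eq_zero)
    hence e: "q / (q * exp (2 * s)) = exp (- 2 * s)" by (simp add: exp_minus divide_inverse)
    have e': "exp (8 * t + 4 * of_real 0 * t + 2 * s) = q * exp (2 * s)"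
      by (simp add: q_def exp_add)
    show ?thesis
      unfolding Psi_triple_product [OF t, of 0 s, folded q_def] e' e
        qpoch_inf_split_head [OF q, of "exp (- 2 * s)"] g_def
      by (simp add: mult_ac)
  qed
  have isCont: "isCont (\<lambda>a. qpoch_inf a q) a" for a
    using continuous_on_interior [OF continuous_on_qpoch_inf [OF q], of a "norm a + 1"] by simp
  have "isCont g 0"
    unfolding g_def by (intro continuous_intros isCont_o2 [OF _ isCont]) 
  hence "(g \<longlongrightarrow> g 0) (at 0)" by (simp add: isCont_def)
  moreover have "((\<lambda>s :: complex. (1 - exp (- 2 * s)) / s) \<longlongrightarrow> 2) (at 0)"
  proof -
    have "((\<lambda>s :: complex. 1 - exp (- 2 * s)) has_field_derivative 2) (at 0)"
      by (rule derivative_eq_intros refl | simp)+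
    thus ?thesis by (simp add: has_field_derivative_iff)
  qed
  ultimately have "((\<lambda>s. (1 - exp (- 2 * s)) / s * g s) \<longlongrightarrow> 2 * g 0) (at 0)"
    by (intro tendsto_mult)
  hence "((\<lambda>s. (Psi 0 0 s t - Psi 0 0 0 t) / (s - 0)) \<longlongrightarrow> 2 * g 0) (at 0)"
    by (simp add: Psi_eq)
  moreover have "((\<lambda>s. (Psi 0 0 s t - Psi 0 0 0 t) / (s - 0)) \<longlongrightarrow> Psi 1 0 0 t) (at 0)"
    using DERIV_Psi_s [OF t, of 0 0 0] by (simp add: has_field_derivative_iff)
  ultimately have "Psi 1 0 0 t = 2 * g 0"
    by (rule LIM_unique [symmetric])
  thus ?thesis by (simp add: g_def power3_eq_cube)
qed

section \<open>The logarithmic derivative of the Euler product\<close>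

text \<open>The double series of d q^(de-1) over d, e >= 1 is summed in two ways: over e first it is
  geometric, and grouped by n + 1 = de it yields divisor sums.\<close>

lemma lambert_series_sums:
  fixes q :: complex
  assumes q: "norm q < 1" and L: "(\<lambda>k. of_nat (Suc k) * q ^ k / (1 - q ^ Suc k)) sums L"
  shows "(\<lambda>n. of_nat (\<Sum>d | d dvd Suc n. d) * q ^ n) sums L"
proof -
  \<comment> \<open>With d = k + 1 and e = m + 1 the exponent de - 1 is k + (k+1)m.\<close>
  define f where "f = (\<lambda>(k, m). of_nat (Suc k) * q ^ (k + Suc k * m))"
  note less_1 = norm_power_Suc_less_1 [OF q]
  have geo: "((\<lambda>m. f (k, m)) has_sum of_nat (Suc k) * q ^ k / (1 - q ^ Suc k)) UNIV"
    and geo_norm: "((\<lambda>m. norm (f (k, m))) has_sum of_nat (Suc k) * norm q ^ k / (1 - norm q ^ Suc k)) UNIV" for k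
  proof -
    have f: "f (k, m) = of_nat (Suc k) * q ^ k * (q ^ Suc k) ^ m" for m
      unfolding f_def prod.case power_add power_mult by (simp only: mult.assoc)
    have nf: "norm (f (k, m)) = of_nat (Suc k) * norm q ^ k * (norm q ^ Suc k) ^ m" for m
      unfolding f norm_mult norm_power norm_of_nat ..
    have s: "(\<lambda>m. norm (f (k, m))) sums (of_nat (Suc k) * norm q ^ k / (1 - norm q ^ Suc k))"
      unfolding nf divide_inverse
      using geometric_sums [of "norm q ^ Suc k"] less_1 [of k]
      by (intro sums_mult) (simp add: norm_power norm_mult divide_inverse)
    thus "((\<lambda>m. norm (f (k, m))) has_sum of_nat (Suc k) * norm q ^ k / (1 - norm q ^ Suc k)) UNIV"
      by (intro norm_summable_imp_has_sum) (auto simp: sums_iff)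
    have "(\<lambda>m. f (k, m)) sums (of_nat (Suc k) * q ^ k / (1 - q ^ Suc k))"
      unfolding f divide_inverse
      using geometric_sums [OF less_1 [of k]] by (intro sums_mult) (simp add: divide_inverse)
    thus "((\<lambda>m. f (k, m)) has_sum of_nat (Suc k) * q ^ k / (1 - q ^ Suc k)) UNIV"
      using s by (intro norm_summable_imp_has_sum) (auto simp: sums_iff)
  qed
  have "(\<lambda>k. of_nat (Suc k) * norm q ^ k * (1 / (1 - norm q))) summable_on UNIV"
    using sums_summable [OF geometric_deriv_sums [of "norm q"]] q
    by (intro summable_nonneg_imp_summable_on) auto
  moreover have "of_nat (Suc k) * norm q ^ k / (1 - norm q ^ Suc k) \<le>
      of_nat (Suc k) * norm q ^ k * (1 / (1 - norm q))" for k
  proof -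
    have "norm q ^ Suc k \<le> norm q ^ 1" using q by (intro power_decreasing) auto
    thus ?thesis
      unfolding divide_inverse [of "_ * _"] using q by (intro mult_left_mono) (auto simp: field_simps)
  qed
  moreover have nonneg: "0 \<le> of_nat (Suc k) * norm q ^ k / (1 - norm q ^ Suc k)" for k
    using less_1 [of k] by (intro divide_nonneg_nonneg mult_nonneg_nonneg) (auto simp: norm_power norm_mult)
  ultimately have sk: "(\<lambda>k. of_nat (Suc k) * norm q ^ k / (1 - norm q ^ Suc k)) summable_on UNIV"
    by (rule summable_on_comparison_test)
  have "(\<lambda>p. norm (f p)) summable_on UNIV \<times> UNIV"
  proof (rule Infinite_Sum.abs_summable_on_Sigma_iff [THEN iffD2], intro conjI ballI)
    show "(\<lambda>m. norm (f (k, m))) summable_on UNIV" for k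
      using geo_norm [of k] by (rule has_sum_imp_summable)
    have "(\<Sum>\<^sub>\<infinity>m. norm (f (k, m))) = of_nat (Suc k) * norm q ^ k / (1 - norm q ^ Suc k)" for k
      using geo_norm by (rule infsumI)
    hence "norm (\<Sum>\<^sub>\<infinity>m. norm (f (k, m))) = of_nat (Suc k) * norm q ^ k / (1 - norm q ^ Suc k)" for k
      by (simp only: real_norm_def abs_of_nonneg nonneg)
    thus "(\<lambda>k. norm (\<Sum>\<^sub>\<infinity>m. norm (f (k, m)))) summable_on UNIV"
      using sk by (simp only:)
  qed
  hence "f summable_on UNIV \<times> UNIV" by (rule abs_summable_summable)
  then obtain S where S: "(f has_sum S) (UNIV \<times> UNIV)" by (auto simp: summable_on_def)
  have "S = L"
    using has_sum_imp_sums [OF has_sum_SigmaD [OF S geo]] L sums_unique2 by blast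
  have iff: "(f has_sum S) (UNIV \<times> UNIV) \<longleftrightarrow>
      ((\<lambda>(n, d). of_nat d * q ^ n) has_sum S) (Sigma UNIV (\<lambda>n. {d. d dvd Suc n}))"
  proof (rule has_sum_reindex_bij_witness
      [of _ "\<lambda>(n, d). (d - 1, Suc n div d - 1)" "\<lambda>(k, m). (k + Suc k * m, Suc k)"])
    fix p :: "nat \<times> nat"
    obtain k m where p: "p = (k, m)" by force
    have "Suc (k + Suc k * m) = Suc k * Suc m" by simp
    thus "(\<lambda>(n, d). (d - 1, Suc n div d - 1)) ((\<lambda>(k, m). (k + Suc k * m, Suc k)) p) = p"
      and "(\<lambda>(k, m). (k + Suc k * m, Suc k)) p \<in> Sigma UNIV (\<lambda>n. {d. d dvd Suc n})"
      unfolding p by (simp_all del: mult_Suc mult_Suc_right)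
    show "(\<lambda>(n, d). of_nat d * q ^ n) ((\<lambda>(k, m). (k + Suc k * m, Suc k)) p) = f p"
      by (simp add: p f_def)
  next
    fix p :: "nat \<times> nat" assume "p \<in> Sigma UNIV (\<lambda>n. {d. d dvd Suc n})"
    then obtain n d where p: "p = (n, d)" and d: "d dvd Suc n" by auto
    then obtain e where e: "Suc n = d * e" by auto
    then obtain d' e' where d': "d = Suc d'" "e = Suc e'" by (cases d; cases e) auto
    have "Suc n div d = e" unfolding e d' by (rule nonzero_mult_div_cancel_left) simp
    thus "(\<lambda>(k, m). (k + Suc k * m, Suc k)) ((\<lambda>(n, d). (d - 1, Suc n div d - 1)) p) = p"
      using e d' by (simp add: p)
  qed auto
  have "((\<lambda>d. case (n, d) of (n, d) \<Rightarrow> of_nat d * q ^ n) has_sum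
      of_nat (\<Sum>d | d dvd Suc n. d) * q ^ n) {d. d dvd Suc n}" for n
    by (rule has_sum_finiteI) (auto simp: sum_distrib_right)
  hence "((\<lambda>n. of_nat (\<Sum>d | d dvd Suc n. d) * q ^ n) has_sum S) UNIV"
    by (rule has_sum_SigmaD [OF S [unfolded iff]])
  thus ?thesis unfolding \<open>S = L\<close> by (rule has_sum_imp_sums)
qed

text \<open>Uniform convergence on a disc of radius r, |q| < r < 1, justifies termwise logarithmic
  differentiation. The result is minus a Lambert series, which \<open>lambert_series_sums\<close>
  identifies as (E2(q) - 1)/(24q).\<close>

lemma DERIV_euler_product:
  fixes q :: complex
  assumes q: "norm q < 1" "q \<noteq> 0"
  shows "((\<lambda>q. qpoch_inf q q) has_field_derivative qpoch_inf q q * (E2 q - 1) / (24 * q)) (at q)"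
proof -
  obtain r where r: "norm q < r" "r < 1" using q(1) dense by blast
  have "uniformly_convergent_on (cball 0 r) (\<lambda>N x :: complex. \<Prod>k<N. 1 - x ^ Suc k)"
  proof (rule uniformly_convergent_on_prod')
    have "norm (norm (1 - x ^ Suc k - 1)) \<le> r ^ Suc k" if "x \<in> cball 0 r" for x :: complex and k
      using that power_mono [of "norm x" r "Suc k"] by (simp add: norm_power norm_mult)
    moreover have "summable (\<lambda>k. r ^ Suc k)"
      using r norm_ge_zero [of q] le_less_trans [of 0 "norm q" r]
      by (subst summable_Suc_iff) (simp add: summable_geometric)
    ultimately show "uniformly_convergent_on (cball 0 r) (\<lambda>N x :: complex. \<Sum>k<N. norm (1 - x ^ Suc k - 1))"
      by (rule Weierstrass_m_test')
  qed (intro continuous_intros compact_cball)+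
  then obtain l where l: "uniform_limit (cball 0 r) (\<lambda>N x :: complex. \<Prod>k<N. 1 - x ^ Suc k) l sequentially"
    by (auto simp: uniformly_convergent_on_def)
  have "l x = qpoch_inf x x" if "x \<in> cball 0 r" for x
  proof (rule LIMSEQ_unique)
    show "(\<lambda>N. \<Prod>k<N. 1 - x ^ Suc k) \<longlonglongrightarrow> l x" using tendsto_uniform_limitI [OF l that] .
    show "(\<lambda>N. \<Prod>k<N. 1 - x ^ Suc k) \<longlonglongrightarrow> qpoch_inf x x"
      using qpoch_inf_LIMSEQ [of x x] that r by simp
  qed
  hence ulim: "uniform_limit (cball 0 r) (\<lambda>N x. \<Prod>k<N. 1 - x ^ Suc k) (\<lambda>x. qpoch_inf x x) sequentially"
    using l by (subst uniform_limit_cong' [where i = l]) auto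
  have holo: "(\<lambda>x. 1 - x ^ Suc k) holomorphic_on A" for k and A :: "complex set"
    by (intro holomorphic_intros)
  have "(\<lambda>x. qpoch_inf x x) holomorphic_on ball 0 r"
    by (rule holomorphic_uniform_limit [OF _ ulim])
      (auto intro!: always_eventually holomorphic_intros continuous_intros)
  hence deriv: "((\<lambda>x. qpoch_inf x x) has_field_derivative deriv (\<lambda>x. qpoch_inf x x) q) (at q)"
    using r by (intro holomorphic_derivI [of _ "ball 0 r"]) auto
  note qq0 = qpoch_inf_self_nonzero [OF q(1)]
  have "(\<lambda>k. deriv (\<lambda>x. 1 - x ^ Suc k) q / (1 - q ^ Suc k)) sums
      (deriv (\<lambda>x. qpoch_inf x x) q / qpoch_inf q q)"
    by (rule logderiv_prodinf_complex_uniform_limit [OF uniform_limit_on_subset [OF ulim ball_subset_cball] holo])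
      (use r qq0 in auto)
  moreover have "deriv (\<lambda>x. 1 - x ^ Suc k) q = - (of_nat (Suc k) * q ^ k)" for k
    by (rule DERIV_imp_deriv) (rule derivative_eq_intros refl | simp)+
  ultimately have "(\<lambda>k. of_nat (Suc k) * q ^ k / (1 - q ^ Suc k)) sums
      (- (deriv (\<lambda>x. qpoch_inf x x) q / qpoch_inf q q))"
    using sums_minus by fastforce
  from lambert_series_sums [OF q(1) this]
  have "(\<lambda>n. of_nat (\<Sum>d | d dvd Suc n. d) * q ^ n * q) sums
      (- (deriv (\<lambda>x. qpoch_inf x x) q / qpoch_inf q q) * q)"
    by (rule sums_mult2)
  hence "E2 q = 1 + 24 * (deriv (\<lambda>x. qpoch_inf x x) q / qpoch_inf q q) * q"
    by (simp add: E2_def sums_iff mult_ac)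
  hence "deriv (\<lambda>x. qpoch_inf x x) q = qpoch_inf q q * (E2 q - 1) / (24 * q)"
    using q qq0 by (simp add: field_simps)
  with deriv show ?thesis by simp
qed

section \<open>Logarithmic derivatives of theta functions\<close>

text \<open>Where Theta_v(0) is nonzero, \<open>L1\<close> to \<open>L4\<close> are the first four
  s-derivatives of log Theta_v at s = 0. The recursions pass from moments to cumulants, so that no
  branch of the logarithm has to be chosen.\<close>

definition L1 :: "real \<Rightarrow> complex \<Rightarrow> complex" where
  "L1 v t = Psi 1 v 0 t / Psi 0 v 0 t"

definition L2 :: "real \<Rightarrow> complex \<Rightarrow> complex" where
  "L2 v t = Psi 2 v 0 t / Psi 0 v 0 t - L1 v t ^ 2"

definition L3 :: "real \<Rightarrow> complex \<Rightarrow> complex" where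
  "L3 v t = Psi 3 v 0 t / Psi 0 v 0 t - 3 * L1 v t * L2 v t - L1 v t ^ 3"

definition L4 :: "real \<Rightarrow> complex \<Rightarrow> complex" where
  "L4 v t = Psi 4 v 0 t / Psi 0 v 0 t - 4 * L1 v t * L3 v t - 3 * L2 v t ^ 2
    - 6 * L1 v t ^ 2 * L2 v t - L1 v t ^ 4"

lemma Psi_conv_L:
  assumes "Psi 0 v 0 t \<noteq> 0"
  shows "Psi 1 v 0 t = L1 v t * Psi 0 v 0 t"
    and "Psi 2 v 0 t = (L2 v t + L1 v t ^ 2) * Psi 0 v 0 t"
    and "Psi 3 v 0 t = (L3 v t + 3 * L1 v t * L2 v t + L1 v t ^ 3) * Psi 0 v 0 t"
    and "Psi 4 v 0 t = (L4 v t + 4 * L1 v t * L3 v t + 3 * L2 v t ^ 2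
      + 6 * L1 v t ^ 2 * L2 v t + L1 v t ^ 4) * Psi 0 v 0 t"
  using assms by (simp_all add: L4_def L3_def L2_def L1_def)

lemma Psi_uminus_char: "Psi k (- v) 0 t = (-1) ^ Suc k * Psi k v 0 t"
  using Psi_minus [of k v 0 t] by simp

lemma Psi_2_minus_char: "Psi k (2 - v) 0 t = (-1) ^ k * Psi k v 0 t"
  using Psi_add_2 [of k "- v" 0 t] by (simp add: Psi_uminus_char)

lemma L1_uminus: "L1 (- v) t = - L1 v t"
  by (simp add: L1_def Psi_uminus_char)

lemma L1_2_minus: "L1 (2 - v) t = - L1 v t"
  by (simp add: L1_def Psi_2_minus_char)

lemma L2_diff:
  assumes t: "Re t < 0" and nz: "Psi 0 v 0 t \<noteq> 0" "Psi 0 v' 0 t \<noteq> 0"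
  shows "L2 v t - L2 v' t = Psi 1 0 0 t ^ 2 * Psi 0 (v + v') 0 t * Psi 0 (v - v') 0 t /
    (Psi 0 v 0 t ^ 2 * Psi 0 v' 0 t ^ 2)"
proof -
  have "Psi 1 0 0 t ^ 2 * Psi 0 (v + v') 0 t * Psi 0 (v - v') 0 t =
      (L2 v t - L2 v' t) * (Psi 0 v 0 t ^ 2 * Psi 0 v' 0 t ^ 2)"
    using Psi_fundamental [OF t, of v v' 0 0]
    unfolding Psi_conv_L [OF nz(1)] Psi_conv_L [OF nz(2)] add_0 diff_0_right by algebra
  thus ?thesis using nz by simp
qed

text \<open>The logarithmic s-derivative of the identity behind \<open>L2_diff\<close>; compare
  wp'(u)/(wp(u) - wp(u')) = zeta(u+u') + zeta(u-u') - 2 zeta(u).\<close>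

lemma L3_addition:
  assumes t: "Re t < 0" and nz: "Psi 0 v 0 t \<noteq> 0" "Psi 0 v' 0 t \<noteq> 0"
    "Psi 0 (v + v') 0 t \<noteq> 0" "Psi 0 (v - v') 0 t \<noteq> 0"
  shows "L3 v t = (L2 v t - L2 v' t) * (L1 (v + v') t + L1 (v - v') t - 2 * L1 v t)"
proof -
  have "Psi 1 0 0 t ^ 2 * Psi 0 (v + v') 0 t * Psi 0 (v - v') 0 t =
      (L2 v t - L2 v' t) * (Psi 0 v 0 t ^ 2 * Psi 0 v' 0 t ^ 2)"
    using L2_diff [OF t nz(1,2)] nz by simp
  hence "L3 v t * (Psi 0 v 0 t ^ 2 * Psi 0 v' 0 t ^ 2) =
      (L2 v t - L2 v' t) * (L1 (v + v') t + L1 (v - v') t - 2 * L1 v t) *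
      (Psi 0 v 0 t ^ 2 * Psi 0 v' 0 t ^ 2)"
    using Psi_fundamental_deriv [OF t, of v v' 0 0]
    unfolding Psi_conv_L [OF nz(1)] Psi_conv_L [OF nz(2)] Psi_conv_L [OF nz(3)] Psi_conv_L [OF nz(4)]
      add_0 diff_0_right by algebra
  thus ?thesis using nz by simp
qed

lemma L3_duplication:
  assumes t: "Re t < 0" and nz: "Psi 0 v 0 t \<noteq> 0"
  shows "L3 v t = Psi 1 0 0 t ^ 3 * Psi 0 (2 * v) 0 t / Psi 0 v 0 t ^ 4"
proof -
  have "Psi 1 0 0 t ^ 3 * Psi 0 (2 * v) 0 t = L3 v t * Psi 0 v 0 t ^ 4"
    using Psi_duplication [OF t, of v 0] unfolding Psi_conv_L [OF nz] mult_zero_right by algebra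
  thus ?thesis using nz by simp
qed

text \<open>The logarithmic s-derivative of the duplication formula for \<open>L3\<close>: the
  numerator Theta_2v(2s) contributes \<open>2 * L1 (2 * v) t\<close>, the fourth power in the
  denominator \<open>- 4 * L1 v t\<close>.\<close>

lemma L4_duplication:
  assumes t: "Re t < 0" and nz: "Psi 0 v 0 t \<noteq> 0" "Psi 0 (2 * v) 0 t \<noteq> 0"
  shows "L4 v t = L3 v t * (2 * L1 (2 * v) t - 4 * L1 v t)"
proof -
  have "Psi 1 0 0 t ^ 3 * Psi 0 (2 * v) 0 t = L3 v t * Psi 0 v 0 t ^ 4"
    using L3_duplication [OF t nz(1)] nz by simp
  hence "L4 v t * Psi 0 v 0 t ^ 4 = L3 v t * (2 * L1 (2 * v) t - 4 * L1 v t) * Psi 0 v 0 t ^ 4"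
    using Psi_duplication_deriv [OF t, of v 0]
    unfolding Psi_conv_L [OF nz(1)] Psi_conv_L [OF nz(2)] mult_zero_right by algebra
  thus ?thesis using nz by simp
qed

text \<open>By the heat equation, \<open>t\<close>-derivatives of these functions are polynomials in them.\<close>

lemma DERIV_Psi_0:
  assumes t: "Re t < 0" and nz: "Psi 0 v 0 t \<noteq> 0"
  shows "((\<lambda>t. Psi 0 v 0 t) has_field_derivative Psi 0 v 0 t * (L2 v t + L1 v t ^ 2)) (at t)"
  using DERIV_Psi_t [OF t, of 0 v 0] Psi_conv_L(2) [OF nz] by (simp add: numeral_2_eq_2 mult.commute)

text \<open>The heat equation gives d/dt log Theta = (log Theta)'' + ((log Theta)')^2. One
  s-derivative of this is the present formula, a second one that of \<open>DERIV_L2\<close>.\<close>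

lemma DERIV_L1:
  assumes t: "Re t < 0" and nz: "Psi 0 v 0 t \<noteq> 0"
  shows "(L1 v has_field_derivative L3 v t + 2 * L1 v t * L2 v t) (at t)"
proof -
  have L1: "(\<lambda>t. Psi 1 v 0 t / Psi 0 v 0 t) = L1 v"
    by (simp add: L1_def fun_eq_iff)
  have "((\<lambda>t. Psi 1 v 0 t) has_field_derivative Psi 3 v 0 t) (at t)"
    using DERIV_Psi_t [OF t, of 1 v 0] by (simp add: numeral_3_eq_3)
  from DERIV_divide [OF this DERIV_Psi_0 [OF t nz] nz, unfolded L1] show ?thesis
    by (rule DERIV_cong)
      (unfold Psi_conv_L [OF nz], use nz in \<open>simp add: field_simps power2_eq_square power3_eq_cube\<close>)
qed

lemma DERIV_L2:
  assumes t: "Re t < 0" and nz: "Psi 0 v 0 t \<noteq> 0"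
  shows "(L2 v has_field_derivative L4 v t + 2 * L1 v t * L3 v t + 2 * L2 v t ^ 2) (at t)"
proof -
  have L2: "(\<lambda>t. Psi 2 v 0 t / Psi 0 v 0 t - L1 v t ^ 2) = L2 v"
    by (simp add: L2_def fun_eq_iff)
  have "((\<lambda>t. Psi 2 v 0 t) has_field_derivative Psi 4 v 0 t) (at t)"
    using DERIV_Psi_t [OF t, of 2 v 0] by (simp add: eval_nat_numeral)
  from DERIV_diff [OF DERIV_divide [OF this DERIV_Psi_0 [OF t nz] nz] DERIV_power [OF DERIV_L1 [OF t nz], of 2],
      unfolded L2] show ?thesis
    by (rule DERIV_cong)
      (use nz in \<open>simp add: Psi_conv_L [OF nz], simp add: field_simps power2_eq_square power3_eq_cube power4_eq_xxxx\<close>)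
qed

section \<open>The septic theta quotients\<close>

text \<open>
  With \<open>h = 2 \<pi> i \<tau>\<close> we have \<open>q = exp h\<close> and \<open>q d/dq = d/dh\<close>; at \<open>t = 7 h / 8\<close> the values of \<open>Psi 0\<close> at the
  characteristics \<open>2/7\<close>, \<open>4/7\<close>, \<open>6/7\<close> are \<open>a\<close>, \<open>- b\<close>, \<open>- c\<close>.
\<close>

definition kap :: "complex \<Rightarrow> complex" where
  "kap h = exp (7 * h / 8) * qpoch_inf (exp (7 * h)) (exp (7 * h)) ^ 3"

text \<open>With the values a, -b, -c the signs in x, y, z fall into one common shape. In
  \<open>X\<close>, \<open>Y\<close>, \<open>Z\<close> the index w is 2v or 2 - 2v: doubling
  permutes the three characteristics cyclically.\<close>

definition theta_quotient :: "real \<Rightarrow> real \<Rightarrow> complex \<Rightarrow> complex" where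
  "theta_quotient v w h = - kap h * Psi 0 v 0 (7 * h / 8) / Psi 0 w 0 (7 * h / 8) ^ 2"

abbreviation "X \<equiv> theta_quotient (4/7) (6/7)"
abbreviation "Y \<equiv> theta_quotient (2/7) (4/7)"
abbreviation "Z \<equiv> theta_quotient (6/7) (2/7)"

lemma Psi_1_conv_kap: "Re h < 0 \<Longrightarrow> Psi 1 0 0 (7 * h / 8) = 2 * kap h"
  using jacobi_cube [of "7 * h / 8"] by (simp add: kap_def)

lemma kap_nonzero:
  assumes "Re h < 0"
  shows "kap h \<noteq> 0"
  using qpoch_inf_self_nonzero [of "exp (7 * h)"] assms by (simp add: kap_def)

lemma DERIV_kap:
  assumes "Re h < 0"
  shows "(kap has_field_derivative 7 / 8 * E2 (exp (7 * h)) * kap h) (at h)"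
proof -
  define e where "e = exp (7 * h)"
  have "e \<noteq> 0" by (simp add: e_def)
  have "((\<lambda>h. exp (7 * h)) has_field_derivative 7 * e) (at h)"
    unfolding e_def by (rule derivative_eq_intros refl | simp)+
  hence "((\<lambda>h. qpoch_inf (exp (7 * h)) (exp (7 * h))) has_field_derivative
      qpoch_inf e e * (E2 e - 1) / (24 * e) * (7 * e)) (at h)"
    using DERIV_euler_product [of e] assms by (intro DERIV_chain2 [where f = "\<lambda>q. qpoch_inf q q"]) (simp_all add: e_def)
  hence D: "((\<lambda>h. qpoch_inf (exp (7 * h)) (exp (7 * h))) has_field_derivative
      7 / 24 * (E2 e - 1) * qpoch_inf e e) (at h)"
    by (rule DERIV_cong) (use \<open>e \<noteq> 0\<close> in \<open>simp add: field_simps\<close>)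
  have "((\<lambda>h. exp (7 * h / 8)) has_field_derivative 7 / 8 * exp (7 * h / 8)) (at h)"
    by (rule derivative_eq_intros refl | simp)+
  from DERIV_mult [OF this DERIV_power [OF D, of 3]] show ?thesis
    unfolding kap_def [abs_def] e_def
    by (rule DERIV_cong) (simp add: field_simps power2_eq_square power3_eq_cube)
qed

lemma septic_relations:
  fixes h :: complex
  assumes h: "Re h < 0"
  defines "t \<equiv> 7 * h / 8" and "x \<equiv> X h" and "y \<equiv> Y h" and "z \<equiv> Z h"
  shows septic_nonzero: "x \<noteq> 0" "y \<noteq> 0" "z \<noteq> 0"
    and septic_conic: "x * z = x * y + y * z"
    and septic_L2: "L2 (4/7) t = L2 (2/7) t + 4 * y * z" "L2 (6/7) t = L2 (2/7) t + 4 * x * z"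
    and septic_L1: "7 * L1 (2/7) t = - (3 * x + y + 5 * z)" "7 * L1 (4/7) t = x + 5 * y - 3 * z"
      "7 * L1 (6/7) t = 5 * x - 3 * y - z"
    and septic_L3: "L3 (2/7) t = - 8 * x * z ^ 2" "L3 (4/7) t = - 8 * y ^ 2 * z" "L3 (6/7) t = - 8 * x ^ 2 * y"
    and septic_L4: "L4 (2/7) t = L3 (2/7) t * (2 * L1 (4/7) t - 4 * L1 (2/7) t)"
proof -
  define a b c k where "a = Psi 0 (2/7) 0 t" and "b = Psi 0 (4/7) 0 t" and "c = Psi 0 (6/7) 0 t"
    and "k = kap h"
  have t: "Re t < 0" using h by (simp add: t_def)
  have nz: "a \<noteq> 0" "b \<noteq> 0" "c \<noteq> 0" using Psi_nonzero [OF t] by (simp_all add: a_def b_def c_def)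
  note nz' = nz [unfolded a_def b_def c_def]
  have k: "k \<noteq> 0" "Psi 1 0 0 t = 2 * k"
    using kap_nonzero [OF h] Psi_1_conv_kap [OF h] by (simp_all add: k_def t_def)
  have xyz: "x = - k * b / c ^ 2" "y = - k * a / b ^ 2" "z = - k * c / a ^ 2"
    by (simp_all add: x_def y_def z_def theta_quotient_def a_def b_def c_def k_def t_def)
  show nzx: "x \<noteq> 0" "y \<noteq> 0" "z \<noteq> 0" using k nz by (simp_all add: xyz)
  \<comment> \<open>The sums, differences and doubles of the three characteristics, folded back by
    oddness and the period 2.\<close>
  have F: "Psi 0 (- (2/7)) 0 t = - a" "Psi 0 (- (4/7)) 0 t = - b" "Psi 0 (8/7) 0 t = c"
    "Psi 0 (10/7) 0 t = b" "Psi 0 (12/7) 0 t = a"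
    using Psi_uminus_char [of 0 "2/7" t] Psi_uminus_char [of 0 "4/7" t] Psi_2_minus_char [of 0 "6/7" t]
      Psi_2_minus_char [of 0 "4/7" t] Psi_2_minus_char [of 0 "2/7" t]
    by (simp_all add: a_def b_def c_def)
  have L: "L1 (- (2/7)) t = - L1 (2/7) t" "L1 (8/7) t = - L1 (6/7) t" "L1 (10/7) t = - L1 (4/7) t"
    using L1_uminus [of "2/7" t] L1_2_minus [of "6/7" t] L1_2_minus [of "4/7" t] by simp_all
  note L2 = L2_diff [OF t, of "2/7" "4/7", OF nz'(1,2)] L2_diff [OF t, of "2/7" "6/7", OF nz'(1,3)]
    L2_diff [OF t, of "4/7" "6/7", OF nz'(2,3)]
  have L2': "L2 (2/7) t - L2 (4/7) t = - 4 * y * z" "L2 (2/7) t - L2 (6/7) t = - 4 * x * z"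
    "L2 (4/7) t - L2 (6/7) t = - 4 * x * y"
    using L2 nz k by (simp_all add: F a_def [symmetric] b_def [symmetric] c_def [symmetric] xyz field_simps
        power2_eq_square)
  show "L2 (4/7) t = L2 (2/7) t + 4 * y * z" "L2 (6/7) t = L2 (2/7) t + 4 * x * z"
    using L2' by (simp_all add: algebra_simps)
  \<comment> \<open>The first and third differences in \<open>L2'\<close> telescope to the
    second.\<close>
  have "4 * (x * z - (x * y + y * z)) = 0" using L2' by algebra
  hence "x * z - (x * y + y * z) = 0" by (subst (asm) mult_eq_0_iff) simp
  thus conic: "x * z = x * y + y * z" by simp
  show L3: "L3 (2/7) t = - 8 * x * z ^ 2" "L3 (4/7) t = - 8 * y ^ 2 * z" "L3 (6/7) t = - 8 * x ^ 2 * y"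
    using L3_duplication [OF t nz'(1)] L3_duplication [OF t nz'(2)] L3_duplication [OF t nz'(3)] nz k
    by (simp_all add: F a_def [symmetric] b_def [symmetric] c_def [symmetric] xyz field_simps eval_nat_numeral)
  \<comment> \<open>The addition formula is compared with the monomials \<open>L3\<close>. The conic
    relation exposes a common nonzero monomial, and cancelling it leaves three linear equations of
    determinant -28 for the three values of \<open>L1\<close>.\<close>
  have "L3 (2/7) t = (L2 (2/7) t - L2 (4/7) t) * (L1 (6/7) t - 3 * L1 (2/7) t)"
    "L3 (4/7) t = (L2 (4/7) t - L2 (6/7) t) * (- L1 (2/7) t - 3 * L1 (4/7) t)"
    "L3 (6/7) t = (L2 (6/7) t - L2 (2/7) t) * (L1 (4/7) t - 3 * L1 (6/7) t)"
    using L3_addition [OF t, of "2/7" "4/7"] L3_addition [OF t, of "4/7" "6/7"]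
      L3_addition [OF t, of "6/7" "2/7"] nz
    by (simp_all add: F L a_def [symmetric] b_def [symmetric] c_def [symmetric])
  hence "4 * (z * y * (L1 (6/7) t - 3 * L1 (2/7) t - 2 * (x + z))) = 0"
    "4 * (x * y * (- L1 (2/7) t - 3 * L1 (4/7) t - 2 * (z - y))) = 0"
    "4 * (x * z * (L1 (4/7) t - 3 * L1 (6/7) t + 2 * (x - y))) = 0"
    using L2' L3 conic by algebra+
  hence "L1 (6/7) t - 3 * L1 (2/7) t - 2 * (x + z) = 0"
    "- L1 (2/7) t - 3 * L1 (4/7) t - 2 * (z - y) = 0"
    "L1 (4/7) t - 3 * L1 (6/7) t + 2 * (x - y) = 0"
    using nzx by (simp_all only: mult_eq_0_iff) simp_all
  thus "7 * L1 (2/7) t = - (3 * x + y + 5 * z)" "7 * L1 (4/7) t = x + 5 * y - 3 * z"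
      "7 * L1 (6/7) t = 5 * x - 3 * y - z"
    by algebra+
  show "L4 (2/7) t = L3 (2/7) t * (2 * L1 (4/7) t - 4 * L1 (2/7) t)"
    using L4_duplication [OF t, of "2/7"] nz by (simp add: a_def b_def)
qed

section \<open>Differential equations in the variable h\<close>

lemma DERIV_theta_quotient:
  fixes v w :: real and h :: complex
  assumes h: "Re h < 0" and vw: "0 < v" "v < 2" "0 < w" "w < 2"
  defines "t \<equiv> 7 * h / 8"
  shows "(theta_quotient v w has_field_derivative 7 / 8 * theta_quotient v w h *
    (E2 (exp (7 * h)) + (L2 v t + L1 v t ^ 2) - 2 * (L2 w t + L1 w t ^ 2))) (at h)"
proof -
  have t: "Re t < 0" using h by (simp add: t_def)
  have scale: "((\<lambda>h. 7 * h / 8) has_field_derivative 7 / 8) (at h)"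
    by (rule derivative_eq_intros refl | simp)+
  have D: "((\<lambda>h. Psi 0 u 0 (7 * h / 8)) has_field_derivative
      Psi 0 u 0 (7 * h / 8) * (L2 u t + L1 u t ^ 2) * (7 / 8)) (at h)" if "0 < u" "u < 2" for u
    using DERIV_chain2 [where f = "\<lambda>t. Psi 0 u 0 t" and g = "\<lambda>h. 7 * h / 8",
        OF DERIV_Psi_0 [OF t Psi_nonzero [OF t that], unfolded t_def] scale] by (simp add: t_def)
  have nz: "Psi 0 w 0 (7 * h / 8) \<noteq> 0" using Psi_nonzero [OF t vw(3,4)] by (simp add: t_def)
  show ?thesis
    unfolding theta_quotient_def [abs_def]
    by (rule derivative_eq_intros D DERIV_kap h vw refl)+
      (use nz in \<open>simp_all add: field_simps power2_eq_square\<close>)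
qed

text \<open>Here p stands for \<open>L2 (2/7) t\<close>, a, b, c for the \<open>L1\<close> values
  and u, v, w for the logarithmic t-derivatives of x, y, z; D equates two derivatives of each linear
  form in L. Each equation of D reduces to that linear form times one common \<open>W\<close>, and
  the three forms are linearly independent, whence x W = 0.\<close>

lemma septic_algebra_P:
  fixes x y z p P a b c u v w :: complex
  assumes rel: "x * z = x * y + y * z"
    and L: "7 * a = - (3 * x + y + 5 * z)" "7 * b = x + 5 * y - 3 * z" "7 * c = 5 * x - 3 * y - z"
    and U: "u = P + (p + 4 * y * z + b ^ 2) - 2 * (p + 4 * x * z + c ^ 2)"
      "v = P + (p + a ^ 2) - 2 * (p + 4 * y * z + b ^ 2)"
      "w = P + (p + 4 * x * z + c ^ 2) - 2 * (p + a ^ 2)"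
    and D: "7 * (- 8 * x * z ^ 2 + 2 * a * p) = - (3 * (x * u) + y * v + 5 * (z * w))"
      "7 * (- 8 * y ^ 2 * z + 2 * b * (p + 4 * y * z)) = x * u + 5 * (y * v) - 3 * (z * w)"
      "7 * (- 8 * x ^ 2 * y + 2 * c * (p + 4 * x * z)) = 5 * (x * u) - 3 * (y * v) - z * w"
  shows "x * (P - (3 * p + x ^ 2 + y ^ 2 + z ^ 2 + 4 * x * z + 4 * y * z)) = 0"
proof -
  define W where "W = P - (3 * p + x ^ 2 + y ^ 2 + z ^ 2 + 4 * x * z + 4 * y * z)"
  have "(3 * x + y + 5 * z) * W = 0" unfolding W_def using rel L U D(1) by algebra
  moreover have "(x + 5 * y - 3 * z) * W = 0" unfolding W_def using rel L U D(2) by algebra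
  moreover have "(5 * x - 3 * y - z) * W = 0" unfolding W_def using rel L U D(3) by algebra
  ultimately have "x * W = 0" by algebra
  thus ?thesis by (simp add: W_def)
qed

lemma DERIV_L_scaled:
  assumes h: "Re h < 0" and v: "0 < v" "v < 2"
  defines "t \<equiv> 7 * h / 8"
  shows "((\<lambda>h. L1 v (7 * h / 8)) has_field_derivative 7 / 8 * (L3 v t + 2 * L1 v t * L2 v t)) (at h)"
    and "((\<lambda>h. L2 v (7 * h / 8)) has_field_derivative
      7 / 8 * (L4 v t + 2 * L1 v t * L3 v t + 2 * L2 v t ^ 2)) (at h)"
proof -
  have t: "Re t < 0" using h by (simp add: t_def)
  note nz = Psi_nonzero [OF t v]
  have scale: "((\<lambda>h. 7 * h / 8) has_field_derivative 7 / 8) (at h)"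
    by (rule derivative_eq_intros refl | simp)+
  show "((\<lambda>h. L1 v (7 * h / 8)) has_field_derivative 7 / 8 * (L3 v t + 2 * L1 v t * L2 v t)) (at h)"
    using DERIV_chain2 [where f = "L1 v" and g = "\<lambda>h. 7 * h / 8",
        OF DERIV_L1 [OF t nz, unfolded t_def] scale] by (simp add: t_def mult.commute)
  show "((\<lambda>h. L2 v (7 * h / 8)) has_field_derivative
      7 / 8 * (L4 v t + 2 * L1 v t * L3 v t + 2 * L2 v t ^ 2)) (at h)"
    using DERIV_chain2 [where f = "L2 v" and g = "\<lambda>h. 7 * h / 8",
        OF DERIV_L2 [OF t nz, unfolded t_def] scale] by (simp add: t_def mult.commute)
qed

lemma has_field_derivative_half_plane_unique:
  assumes "Re h < 0" "\<And>h. Re h < 0 \<Longrightarrow> f h = g h"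
    and "(f has_field_derivative f') (at h)" "(g has_field_derivative g') (at h)"
  shows "f' = g'"
proof -
  have "(g has_field_derivative f') (at h)"
    by (rule has_field_derivative_transform_within_open [OF assms(3) open_halfspace_Re_lt [of 0]])
      (use assms in auto)
  thus ?thesis using assms(4) by (rule DERIV_unique)
qed

lemma E2_conv_L2:
  assumes h: "Re h < 0"
  shows "E2 (exp (7 * h)) = 3 * L2 (2/7) (7 * h / 8) + X h ^ 2 + Y h ^ 2 + Z h ^ 2 + 4 * X h * Z h + 4 * Y h * Z h"
proof -
  define t where "t = 7 * h / 8"
  define P where "P = E2 (exp (7 * h))"
  define u v w where "u = P + (L2 (4/7) t + L1 (4/7) t ^ 2) - 2 * (L2 (6/7) t + L1 (6/7) t ^ 2)"
    and "v = P + (L2 (2/7) t + L1 (2/7) t ^ 2) - 2 * (L2 (4/7) t + L1 (4/7) t ^ 2)"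
    and "w = P + (L2 (6/7) t + L1 (6/7) t ^ 2) - 2 * (L2 (2/7) t + L1 (2/7) t ^ 2)"
  have DX: "(X has_field_derivative 7 / 8 * X h * u) (at h)"
    and DY: "(Y has_field_derivative 7 / 8 * Y h * v) (at h)"
    and DZ: "(Z has_field_derivative 7 / 8 * Z h * w) (at h)"
    unfolding u_def v_def w_def P_def t_def by (rule DERIV_theta_quotient [OF h]; simp)+
  \<comment> \<open>The first linear form for \<open>L1\<close> differentiated in two ways: by the
    heat equation on the left, through \<open>X\<close>, \<open>Y\<close>, \<open>Z\<close> on the
    right. The other two follow in the same manner.\<close>
  have 1: "7 * (7 / 8 * (L3 (2/7) t + 2 * L1 (2/7) t * L2 (2/7) t)) =
      - (3 * (7 / 8 * X h * u) + 7 / 8 * Y h * v + 5 * (7 / 8 * Z h * w))"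
  proof (rule has_field_derivative_half_plane_unique [OF h septic_L1(1)])
    show "((\<lambda>h. 7 * L1 (2/7) (7 * h / 8)) has_field_derivative
        7 * (7 / 8 * (L3 (2/7) t + 2 * L1 (2/7) t * L2 (2/7) t))) (at h)"
      unfolding t_def by (intro DERIV_cmult DERIV_L_scaled h) auto
  qed (assumption, intro DERIV_minus DERIV_add DERIV_cmult DX DY DZ)
  have 2: "7 * (7 / 8 * (L3 (4/7) t + 2 * L1 (4/7) t * L2 (4/7) t)) =
      7 / 8 * X h * u + 5 * (7 / 8 * Y h * v) - 3 * (7 / 8 * Z h * w)"
  proof (rule has_field_derivative_half_plane_unique [OF h septic_L1(2)])
    show "((\<lambda>h. 7 * L1 (4/7) (7 * h / 8)) has_field_derivative
        7 * (7 / 8 * (L3 (4/7) t + 2 * L1 (4/7) t * L2 (4/7) t))) (at h)"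
      unfolding t_def by (intro DERIV_cmult DERIV_L_scaled h) auto
  qed (assumption, intro DERIV_diff DERIV_add DERIV_cmult DX DY DZ)
  have 3: "7 * (7 / 8 * (L3 (6/7) t + 2 * L1 (6/7) t * L2 (6/7) t)) =
      5 * (7 / 8 * X h * u) - 3 * (7 / 8 * Y h * v) - 7 / 8 * Z h * w"
  proof (rule has_field_derivative_half_plane_unique [OF h septic_L1(3)])
    show "((\<lambda>h. 7 * L1 (6/7) (7 * h / 8)) has_field_derivative
        7 * (7 / 8 * (L3 (6/7) t + 2 * L1 (6/7) t * L2 (6/7) t))) (at h)"
      unfolding t_def by (intro DERIV_cmult DERIV_L_scaled h) auto
  qed (assumption, intro DERIV_diff DERIV_add DERIV_cmult DX DY DZ)
  note rels = septic_L2 [OF h, folded t_def] septic_L3 [OF h, folded t_def]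
  have cancel: "a = b" if "7 / 8 * a = 7 / 8 * b" for a b :: complex
    using that by simp
  have "X h * (P - (3 * L2 (2/7) t + X h ^ 2 + Y h ^ 2 + Z h ^ 2 + 4 * X h * Z h + 4 * Y h * Z h)) = 0"
    by (rule septic_algebra_P [OF septic_conic [OF h] septic_L1 [OF h, folded t_def]
          u_def [unfolded rels] v_def [unfolded rels] w_def [unfolded rels]])
      (rule cancel, use 1 2 3 in \<open>simp add: rels algebra_simps\<close>)+
  thus ?thesis using septic_nonzero(1) [OF h] by (simp add: P_def t_def)
qed

text \<open>P eliminates p and L eliminates a, b, c, which leaves polynomials modulo the conic. The
  scaling 21 u = 2 (...) is that of 7/8 x u = x/12 (...).\<close>

lemma septic_algebra_x:
  fixes x y z p P a b c u v w :: complex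
  assumes rel: "x * z = x * y + y * z"
    and L: "7 * a = - (3 * x + y + 5 * z)" "7 * b = x + 5 * y - 3 * z" "7 * c = 5 * x - 3 * y - z"
    and U: "u = P + (p + 4 * y * z + b ^ 2) - 2 * (p + 4 * x * z + c ^ 2)"
      "v = P + (p + a ^ 2) - 2 * (p + 4 * y * z + b ^ 2)"
      "w = P + (p + 4 * x * z + c ^ 2) - 2 * (p + a ^ 2)"
    and P: "P = 3 * p + x ^ 2 + y ^ 2 + z ^ 2 + 4 * x * z + 4 * y * z"
  shows "21 * u = 2 * (5*y^2 + 5*z^2 - 7*x^2 - 20*y*z - 52*x*y + 7*P)"
    "21 * v = 2 * (5*z^2 + 5*x^2 - 7*y^2 + 20*x*z - 52*y*z + 7*P)"
    "21 * w = 2 * (5*x^2 + 5*y^2 - 7*z^2 - 20*x*y + 52*x*z + 7*P)"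
  using assms by algebra+

text \<open>The outer factor 3 multiplies the t-derivative of the formula for P, with
  \<open>L3\<close> and \<open>L4\<close> replaced by their values. The factors 3 and 2 reflect that
  7/8 A = 7/12 B means 3 A = 2 B.\<close>

lemma septic_algebra_DP:
  fixes x y z p P a b u v w :: complex
  assumes rel: "x * z = x * y + y * z"
    and L: "7 * a = - (3 * x + y + 5 * z)" "7 * b = x + 5 * y - 3 * z"
    and U: "21 * u = 2 * (5*y^2 + 5*z^2 - 7*x^2 - 20*y*z - 52*x*y + 7*P)"
    "21 * v = 2 * (5*z^2 + 5*x^2 - 7*y^2 + 20*x*z - 52*y*z + 7*P)"
    "21 * w = 2 * (5*x^2 + 5*y^2 - 7*z^2 - 20*x*y + 52*x*z + 7*P)"
    and P: "P = 3 * p + x ^ 2 + y ^ 2 + z ^ 2 + 4 * x * z + 4 * y * z"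
  shows "3 * (3 * (- 8 * x * z ^ 2 * (2 * b - 4 * a) + 2 * a * (- 8 * x * z ^ 2) + 2 * p ^ 2) +
     2 * x * (x * u) + 2 * y * (y * v) + 2 * z * (z * w) + 4 * (x * (z * w) + (x * u) * z) + 4 * (y * (z * w) + (y * v) * z)) =
     2 * (P^2 - x^4 + 4*x^3*y + 12*x*y^3 - y^4 - 12*x^3*z + 4*y^3*z
                     - 4*x*z^3 + 12*y*z^3 - z^4)"
  using assms by algebra

section \<open>Return from h to q\<close>

lemma has_field_derivative_via_exp:
  assumes q: "q \<noteq> 0" and f: "\<And>h. f (exp h) = g h"
    and g: "(g has_field_derivative g') (at (Ln q))"
  shows "(f has_field_derivative g' / q) (at q)"
proof -
  \<comment> \<open>This is a logarithm of w that is holomorphic near q because w/q is near 1, even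
    if q lies on the branch cut of \<open>Ln\<close>.\<close>
  have "((\<lambda>w. Ln q + Ln (w / q)) has_field_derivative 1 / q) (at q)"
    using q by (auto intro!: derivative_eq_intros)
  hence "((\<lambda>w. g (Ln q + Ln (w / q))) has_field_derivative g' * (1 / q)) (at q)"
    using g q by (intro DERIV_chain2 [where f = g]) simp_all
  hence "((\<lambda>w. g (Ln q + Ln (w / q))) has_field_derivative g' / q) (at q)" by simp
  moreover have "g (Ln q + Ln (w / q)) = f w" if "w \<in> - {0}" for w
    using q that by (simp add: exp_add flip: f)
  ultimately show ?thesis
    using q by (auto intro: has_field_derivative_transform_within_open [of _ _ _ "- {0}"])
qed

text \<open>Since (14n+m)^2/56 = 7/8 (2n + m/7)^2, the characteristic is m/7 - 1: m = 5, 3, 1 give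
  -2/7, -4/7, -6/7.\<close>

lemma theta7_conv_Psi:
  "theta7 m (h / (2 * of_real pi * \<i>)) = Psi 0 ((real m - 7) / 7) 0 (7 * h / 8)"
proof -
  have "qpow (h / (2 * of_real pi * \<i>)) ((14 * of_int n + real m)\<^sup>2 / 56) =
      exp (of_real (2 * of_int n + 1 + (real m - 7) / 7) ^ 2 * (7 * h / 8))" for n :: int
  proof -
    have "(14 * of_int n + real m)\<^sup>2 / 56 = 7 / 8 * (2 * of_int n + 1 + (real m - 7) / 7)\<^sup>2"
      by (simp add: field_simps power2_eq_square)
    thus ?thesis by (simp only: qpow_def) (simp add: mult_ac)
  qed
  thus ?thesis by (simp add: theta7_def Psi_def Psi_term_def)
qed

lemma theta_quotients_of_exp:
  shows x_of_q_conv: "x_of_q (exp h) = X h"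
    and y_of_q_conv: "y_of_q (exp h) = Y h"
    and z_of_q_conv: "z_of_q (exp h) = Z h"
proof -
  define \<tau> where "\<tau> = h / (2 * of_real pi * \<i>)"
  have h: "exp h = exp (2 * of_real pi * \<i> * \<tau>)" by (simp add: \<tau>_def)
  have qpow: "qpow \<tau> r = exp (of_real r * h)" for r
    by (simp add: qpow_def \<tau>_def mult_ac)
  have kap: "qpow \<tau> (7/8) * qpoch_inf (qpow \<tau> 1 ^ 7) (qpow \<tau> 1 ^ 7) ^ 3 = kap h"
    by (simp add: qpow kap_def flip: exp_of_nat_mult)
  have abc: "a_tau \<tau> = Psi 0 (2/7) 0 (7 * h / 8)" "b_tau \<tau> = - Psi 0 (4/7) 0 (7 * h / 8)"
    "c_tau \<tau> = - Psi 0 (6/7) 0 (7 * h / 8)"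
    using Psi_uminus_char [of 0 "2/7"] Psi_uminus_char [of 0 "4/7"] Psi_uminus_char [of 0 "6/7"]
    by (simp_all add: a_tau_def b_tau_def c_tau_def \<tau>_def theta7_conv_Psi)
  show "x_of_q (exp h) = X h" "y_of_q (exp h) = Y h" "z_of_q (exp h) = Z h"
    unfolding h x_of_q_exp y_of_q_exp z_of_q_exp x_tau_def y_tau_def z_tau_def
    using kap by (simp_all add: abc theta_quotient_def)
qed

theorem theorem1p1:
  fixes q x y z P :: complex
  assumes "0 < norm q" and "norm q < 1"
    and "x = x_of_q q" and "y = y_of_q q" and "z = z_of_q q" and "P = P_of_q q"
  shows "x_of_q field_differentiable (at q) \<and>
         q * deriv x_of_q q =
           x / 12 * (5*y^2 + 5*z^2 - 7*x^2 - 20*y*z - 52*x*y + 7*P) \<and>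
         y_of_q field_differentiable (at q) \<and>
         q * deriv y_of_q q =
           y / 12 * (5*z^2 + 5*x^2 - 7*y^2 + 20*x*z - 52*y*z + 7*P) \<and>
         z_of_q field_differentiable (at q) \<and>
         q * deriv z_of_q q =
           z / 12 * (5*x^2 + 5*y^2 - 7*z^2 - 20*x*y + 52*x*z + 7*P) \<and>
         P_of_q field_differentiable (at q) \<and>
         q * deriv P_of_q q =
           7 / 12 * (P^2 - x^4 + 4*x^3*y + 12*x*y^3 - y^4 - 12*x^3*z + 4*y^3*z
                     - 4*x*z^3 + 12*y*z^3 - z^4)"
proof -
  define h where "h = Ln q"
  define t where "t = 7 * h / 8"
  have q: "q \<noteq> 0" "q = exp h" using assms by (auto simp: h_def)
  have h: "Re h < 0" using assms by (simp add: h_def)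
  have xyz: "X h = x" "Y h = y" "Z h = z"
    unfolding assms q(2) by (simp_all add: theta_quotients_of_exp)
  have P_exp: "P_of_q (exp h) = E2 (exp (7 * h))" for h
    by (simp add: P_of_q_def flip: exp_of_nat_mult)
  have P: "E2 (exp (7 * h)) = P" unfolding assms q(2) by (rule P_exp [symmetric])
  define u v w where "u = P + (L2 (4/7) t + L1 (4/7) t ^ 2) - 2 * (L2 (6/7) t + L1 (6/7) t ^ 2)"
    and "v = P + (L2 (2/7) t + L1 (2/7) t ^ 2) - 2 * (L2 (4/7) t + L1 (4/7) t ^ 2)"
    and "w = P + (L2 (6/7) t + L1 (6/7) t ^ 2) - 2 * (L2 (2/7) t + L1 (2/7) t ^ 2)"
  note L = septic_L1 [OF h, folded t_def, unfolded xyz]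
  note rels = septic_L2 [OF h, folded t_def, unfolded xyz]
  note conic = septic_conic [OF h, unfolded xyz]
  have E2: "P = 3 * L2 (2/7) t + x ^ 2 + y ^ 2 + z ^ 2 + 4 * x * z + 4 * y * z"
    using E2_conv_L2 [OF h] by (simp add: P xyz t_def)
  have DX: "(X has_field_derivative 7 / 8 * x * u) (at h)"
    and DY: "(Y has_field_derivative 7 / 8 * y * v) (at h)"
    and DZ: "(Z has_field_derivative 7 / 8 * z * w) (at h)"
    unfolding u_def v_def w_def t_def P [symmetric] xyz [symmetric]
    by (rule DERIV_theta_quotient [OF h]; simp)+
  note uvw = septic_algebra_x [OF conic L u_def [unfolded rels] v_def [unfolded rels] w_def [unfolded rels] E2]
  \<comment> \<open>The h-derivative of the right side of \<open>E2_conv_L2\<close>, which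
    represents P on the whole half-plane Re h < 0.\<close>
  define P' where "P' = 3 * (7 / 8 * (L4 (2/7) t + 2 * L1 (2/7) t * L3 (2/7) t + 2 * L2 (2/7) t ^ 2)) +
    2 * x * (7 / 8 * x * u) + 2 * y * (7 / 8 * y * v) + 2 * z * (7 / 8 * z * w) +
    4 * (x * (7 / 8 * z * w) + 7 / 8 * x * u * z) + 4 * (y * (7 / 8 * z * w) + 7 / 8 * y * v * z)"
  have "((\<lambda>h. 3 * L2 (2/7) (7 * h / 8) + X h ^ 2 + Y h ^ 2 + Z h ^ 2 + 4 * X h * Z h + 4 * Y h * Z h)
      has_field_derivative P') (at h)"
    by (rule derivative_eq_intros DX DY DZ DERIV_L_scaled(2) [OF h] refl | simp)+
      (simp add: P'_def xyz t_def algebra_simps)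
  hence DP: "((\<lambda>h. E2 (exp (7 * h))) has_field_derivative P') (at h)"
    by (rule has_field_derivative_transform_within_open [OF _ open_halfspace_Re_lt [of 0]])
      (use h E2_conv_L2 in auto)
  have P': "P' = 7 / 12 * (P^2 - x^4 + 4*x^3*y + 12*x*y^3 - y^4 - 12*x^3*z + 4*y^3*z
      - 4*x*z^3 + 12*y*z^3 - z^4)"
  proof -
    have "P' = 7 / 8 * a" if "a = 3 * (- 8 * x * z ^ 2 * (2 * L1 (4/7) t - 4 * L1 (2/7) t) +
        2 * L1 (2/7) t * (- 8 * x * z ^ 2) + 2 * L2 (2/7) t ^ 2) +
        2 * x * (x * u) + 2 * y * (y * v) + 2 * z * (z * w) + 4 * (x * (z * w) + (x * u) * z) +
        4 * (y * (z * w) + (y * v) * z)" for a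
      unfolding P'_def septic_L4 [OF h, folded t_def] septic_L3(1) [OF h, folded t_def] xyz that
      by (simp add: algebra_simps)
    moreover have "7 / 8 * a = 7 / 12 * b" if "3 * a = 2 * b" for a b :: complex
      using that by (simp add: field_simps)
    ultimately show ?thesis using septic_algebra_DP [OF conic L(1,2) uvw E2] by metis
  qed
  have 12: "7 / 8 * a * b = a / 12 * c" if "21 * b = 2 * c" for a b c :: complex
    using that by (simp add: field_simps)
  \<comment> \<open>If f (exp h) = g h, then f' = g'/q at q, so q f' is exactly the h-derivative of
    g.\<close>
  have deriv: "f field_differentiable (at q) \<and> q * deriv f q = c"
    if "\<And>h. f (exp h) = g h" "(g has_field_derivative c) (at h)" for f g c
    using has_field_derivative_via_exp [OF q(1) that(1) that(2) [unfolded h_def]] q(1)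
    by (auto simp: field_differentiable_def dest: DERIV_imp_deriv)
  show ?thesis
    using deriv [OF x_of_q_conv DX] deriv [OF y_of_q_conv DY] deriv [OF z_of_q_conv DZ]
      deriv [OF P_exp DP]
    unfolding 12 [OF uvw(1)] 12 [OF uvw(2)] 12 [OF uvw(3)] P' by blast
qed

end
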